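(* Let $X$ be a complex Banach space and let $T \in \mathcal{B}(X)$ be such that there exists $\mu\in\partial\sigma(T)$ that is not an eigenvalue of $T$. Then $T$ admits an almost-invariant half-space with defect one.
   Context: All Banach spaces are complex and all subspaces are norm closed. $\mathcal{B}(X)$ is the algebra of bounded linear operators on $X$; $\sigma(T)$ is the spectrum of $T$ and $\partial\sigma(T)$ its topological boundary in $\mathbb{C}$. A (closed) subspace $Y\subseteq X$ is called almost-invariant for $T$ if there is a finite-dimensional subspace $M\subseteq X$ such that $TY\subseteq Y+M$; the minimal dimension of such an $M$ is called the defect of $Y$ for $T$. A half-space of $X$ is a closed subspace that has both infinite dimension and infinite codimension in $X$. An almost-invariant half-space for $T$ is a half-space that is almost-invariant for $T$. *)

theory Defs
  imports "HOL-Analysis.Analysis" "HOL-Library.Set_Algebras"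
begin

class complex_vector = real_vector +
  fixes scaleC :: "complex \<Rightarrow> 'a \<Rightarrow> 'a"  (infixr "*\<^sub>C" 75)
  assumes scaleC_add_right: "c *\<^sub>C (x + y) = c *\<^sub>C x + c *\<^sub>C y"
    and scaleC_add_left: "(c + d) *\<^sub>C x = c *\<^sub>C x + d *\<^sub>C x"
    and scaleC_scaleC: "c *\<^sub>C (d *\<^sub>C x) = (c * d) *\<^sub>C x"
    and scaleC_of_real: "complex_of_real r *\<^sub>C x = r *\<^sub>R x"

class complex_normed_vector = complex_vector + real_normed_vector +
  assumes norm_scaleC: "norm (c *\<^sub>C x) = cmod c * norm x"

class complex_banach = complex_normed_vector + complete_space

subclass (in complex_banach) banach ..

global_interpretation complex_vector:
  vector_space "scaleC :: complex \<Rightarrow> 'a \<Rightarrow> 'a::complex_vector"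
proof
  show "1 *\<^sub>C x = x" for x :: 'a
    using scaleC_of_real[of 1 x] by simp
qed (simp_all add: scaleC_add_right scaleC_add_left scaleC_scaleC)

definition bounded_clinear :: "('a::complex_normed_vector \<Rightarrow> 'a) \<Rightarrow> bool"
  where "bounded_clinear T \<longleftrightarrow> bounded_linear T \<and> (\<forall>c x. T (c *\<^sub>C x) = c *\<^sub>C T x)"

text \<open>The inverse of \<open>T - z I\<close> is required to lie in the algebra of bounded
  complex-linear operators.\<close>

definition spectrum :: "('a::complex_normed_vector \<Rightarrow> 'a) \<Rightarrow> complex set"
  where "spectrum T = {z. \<not> (\<exists>S. bounded_clinear S \<and>
    (\<forall>x. S (T x - z *\<^sub>C x) = x) \<and> (\<forall>x. T (S x) - z *\<^sub>C S x = x))}"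

definition eigenvalue :: "('a::complex_vector \<Rightarrow> 'a) \<Rightarrow> complex \<Rightarrow> bool"
  where "eigenvalue T z \<longleftrightarrow> (\<exists>x. x \<noteq> 0 \<and> T x = z *\<^sub>C x)"

definition fin_dim_subspace :: "'a::complex_vector set \<Rightarrow> bool"
  where "fin_dim_subspace M \<longleftrightarrow> (\<exists>B. finite B \<and> M = complex_vector.span B)"

text \<open>A subspace \<open>Y\<close> has finite codimension when \<open>X / Y\<close> is spanned by the cosets
  of finitely many vectors; \<open>M\<close> below is the span of such representatives.\<close>

definition fin_codim_subspace :: "'a::complex_vector set \<Rightarrow> bool"
  where "fin_codim_subspace Y \<longleftrightarrow>
    complex_vector.subspace Y \<and> (\<exists>M. fin_dim_subspace M \<and> Y + M = UNIV)"

definition half_space :: "'a::complex_normed_vector set \<Rightarrow> bool"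
  where "half_space Y \<longleftrightarrow> complex_vector.subspace Y \<and> closed Y \<and>
    \<not> fin_dim_subspace Y \<and> \<not> fin_codim_subspace Y"

definition almost_invariant :: "('a::complex_normed_vector \<Rightarrow> 'a) \<Rightarrow> 'a set \<Rightarrow> bool"
  where "almost_invariant T Y \<longleftrightarrow> complex_vector.subspace Y \<and> closed Y \<and>
    (\<exists>M. fin_dim_subspace M \<and> T ` Y \<subseteq> Y + M)"

text \<open>Only meaningful when \<open>Y\<close> is almost-invariant for \<open>T\<close>; otherwise the set of
  admissible dimensions is empty and its least element unspecified.\<close>

definition defect :: "('a::complex_normed_vector \<Rightarrow> 'a) \<Rightarrow> 'a set \<Rightarrow> nat"
  where "defect T Y =
    (LEAST n. \<exists>M. fin_dim_subspace M \<and> complex_vector.dim M = n \<and> T ` Y \<subseteq> Y + M)"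

end

theory Submission
  imports Defs
begin

text \<open>Let \<open>\<mu>\<close> be the given boundary point. For resolvent points \<open>l n\<close> tending to \<open>\<mu>\<close> the norms of
  the resolvents blow up, so by uniform boundedness they blow up on some vector \<open>e\<close>. The
  normalized vectors \<open>x n\<close> obtained from \<open>e\<close> are approximate eigenvectors for \<open>\<mu>\<close> and
  satisfy \<open>T (x n) \<in> span {x n, e}\<close>, so the closed span of any family of them is invariant modulo \<open>e\<close>.
  Let \<open>\<phi>\<close> be a weak-star cluster point of \<open>x\<close> in the bidual. As \<open>\<mu>\<close> is not an eigenvalue, \<open>\<phi>\<close> is
  either 0 or outside the space itself; in both cases the functionals killed by \<open>\<phi>\<close> define an
  equivalent norm, and on them \<open>x\<close> clusters at 0. Mazur's construction in this norm, started at \<open>e\<close>,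
  selects terms of \<open>x\<close> which together with \<open>e\<close> form a minimal sequence. Every other selected term
  then spans a half-space, and \<open>e\<close> does not belong to it, whence the defect is not 0.\<close>

section \<open>Norming functionals\<close>

lemma bounded_linear_scaleC_left: "bounded_linear (\<lambda>c. c *\<^sub>C (x::'a::complex_normed_vector))"
proof (rule bounded_linear_intro[where K = "norm x"])
  fix r :: real and c :: complex
  show "(r *\<^sub>R c) *\<^sub>C x = r *\<^sub>R (c *\<^sub>C x)"
    unfolding scaleC_of_real[symmetric] scaleR_conv_of_real scaleC_scaleC ..
qed (simp_all add: scaleC_add_left norm_scaleC)

lemma bounded_linear_scaleC_right: "bounded_linear (\<lambda>x::'a::complex_normed_vector. c *\<^sub>C x)"
proof (rule bounded_linear_intro[where K = "cmod c"])
  fix r :: real and x :: 'a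
  show "c *\<^sub>C (r *\<^sub>R x) = r *\<^sub>R (c *\<^sub>C x)"
    unfolding scaleC_of_real[symmetric] scaleC_scaleC by (simp only: mult.commute)
qed (simp_all add: scaleC_add_right norm_scaleC mult.commute)

text \<open>The complex dual: \<open>bounded_linear\<close> covers real scalars only, so complex
  homogeneity is a separate clause.\<close>

definition cfunctional :: "('a::complex_normed_vector \<Rightarrow> complex) \<Rightarrow> bool"
  where "cfunctional f \<longleftrightarrow> bounded_linear f \<and> (\<forall>c x. f (c *\<^sub>C x) = c * f x)"

lemma cfunctional_add: "cfunctional f \<Longrightarrow> f (x + y) = f x + f y"
  unfolding cfunctional_def by (simp add: bounded_linear.linear linear_add)

lemma cfunctional_diff: "cfunctional f \<Longrightarrow> f (x - y) = f x - f y"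
  unfolding cfunctional_def by (simp add: bounded_linear.linear linear_diff)

lemma cfunctional_scaleC: "cfunctional f \<Longrightarrow> f (c *\<^sub>C x) = c * f x"
  unfolding cfunctional_def by simp

lemma cfunctional_bounded_linear: "cfunctional f \<Longrightarrow> bounded_linear f"
  unfolding cfunctional_def by simp

section \<open>Hahn-Banach by minimal sublinear functionals\<close>

definition sublinear :: "('a::real_vector \<Rightarrow> real) \<Rightarrow> bool"
  where "sublinear p \<longleftrightarrow> (\<forall>x y. p (x + y) \<le> p x + p y) \<and> (\<forall>t\<ge>0. \<forall>x. p (t *\<^sub>R x) = t * p x)"

lemma sublinear_zero: "sublinear p \<Longrightarrow> p 0 = 0"
  unfolding sublinear_def by (metis mult_zero_left order_refl scaleR_zero_left)

lemma sublinear_ge_minus: "sublinear p \<Longrightarrow> - p (- x) \<le> p x"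
proof -
  assume p: "sublinear p"
  then have "p (x + - x) \<le> p x + p (- x)" unfolding sublinear_def by blast
  then show ?thesis using sublinear_zero[OF p] by simp
qed

text \<open>A minimal sublinear functional is not changed by this lowering for any \<open>y\<close>, hence is
  additive, hence linear.\<close>

lemma sublinear_lower:
  fixes q :: "'a::real_vector \<Rightarrow> real"
  assumes q: "sublinear q"
  obtains q' where "sublinear q'" "\<And>x. q' x \<le> q x" "\<And>x. q' x \<le> q (x + y) - q y"
proof
  \<comment> \<open>The infimum of \<open>h x\<close> runs over a ray in direction \<open>y\<close>:
    t = 0 and t = 1 give the two upper bounds, and \<open>t * q y = q (t *\<^sub>R y)\<close> for
    nonnegative t gives the lower bound \<open>- q (- x)\<close>.\<close>
  define h where "h x t = q (x + t *\<^sub>R y) - t * q y" for x t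
  define q' where "q' x = (INF t\<in>{0..}. h x t)" for x
  have bdd: "bdd_below (h x ` {0..})" for x
  proof (rule bdd_belowI2[where m = "- q (- x)"])
    fix t :: real assume "t \<in> {0..}"
    then have "t * q y = q ((x + t *\<^sub>R y) + - x)"
      using q by (simp add: sublinear_def)
    also have "\<dots> \<le> q (x + t *\<^sub>R y) + q (- x)"
      using q unfolding sublinear_def by blast
    finally show "- q (- x) \<le> h x t" by (simp add: h_def)
  qed
  have lower: "q' x \<le> h x t" if "t \<ge> 0" for x t
    unfolding q'_def using that by (intro cINF_lower bdd) auto
  have greatest: "c \<le> q' x" if "\<And>t. t \<ge> 0 \<Longrightarrow> c \<le> h x t" for c x
    unfolding q'_def using that by (intro cINF_greatest) auto
  show "q' x \<le> q x" for x using lower[of 0 x] by (simp add: h_def)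
  show "q' x \<le> q (x + y) - q y" for x using lower[of 1 x] by (simp add: h_def)
  have add: "q' (x + z) \<le> q' x + q' z" for x z
  proof -
    have "q' (x + z) - h x s \<le> h z t" if "s \<ge> 0" "t \<ge> 0" for s t
    proof -
      have "q' (x + z) \<le> h (x + z) (s + t)" using that by (intro lower) auto
      also have "\<dots> = q ((x + s *\<^sub>R y) + (z + t *\<^sub>R y)) - (s + t) * q y"
        by (simp add: h_def algebra_simps)
      also have "\<dots> \<le> h x s + h z t"
      proof -
        have "q ((x + s *\<^sub>R y) + (z + t *\<^sub>R y)) \<le> q (x + s *\<^sub>R y) + q (z + t *\<^sub>R y)"
          using q unfolding sublinear_def by blast
        then show ?thesis by (simp add: h_def algebra_simps)
      qed
      finally show ?thesis by simp
    qed
    then have "q' (x + z) - h x s \<le> q' z" if "s \<ge> 0" for s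
      using that by (intro greatest) auto
    then have "q' (x + z) - q' z \<le> q' x" by (intro greatest) (simp add: algebra_simps)
    then show ?thesis by simp
  qed
  have pos: "t * q' x \<le> q' (t *\<^sub>R x)" if "t > 0" for t x
  proof (rule greatest)
    fix s :: real assume "s \<ge> 0"
    then have "q' x \<le> h x (s / t)" using that by (intro lower) auto
    then have "t * q' x \<le> t * h x (s / t)" using that by simp
    also have "\<dots> = h (t *\<^sub>R x) s"
    proof -
      have "t * q (x + (s / t) *\<^sub>R y) = q (t *\<^sub>R (x + (s / t) *\<^sub>R y))"
        using q that by (simp add: sublinear_def)
      then show ?thesis using that by (simp add: h_def algebra_simps)
    qed
    finally show "t * q' x \<le> h (t *\<^sub>R x) s" .
  qed
  have "q' 0 \<ge> 0"
    by (rule greatest) (use q in \<open>auto simp: h_def sublinear_def\<close>)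
  then have zero: "q' 0 = 0" using lower[of 0 0] sublinear_zero[OF q] by (simp add: h_def)
  have hom: "q' (t *\<^sub>R x) = t * q' x" if "t \<ge> 0" for t x
  proof (cases "t = 0")
    case False
    with that have "t > 0" by simp
    from pos[of "inverse t" "t *\<^sub>R x"] have "q' (t *\<^sub>R x) \<le> t * q' x"
      using \<open>t > 0\<close> by (simp add: field_simps)
    with pos[OF \<open>t > 0\<close>] show ?thesis by (simp add: antisym)
  qed (simp add: zero)
  show "sublinear q'" unfolding sublinear_def using add hom by blast
qed

text \<open>Zorn's lemma yields a minimal sublinear functional below \<open>p\<close>, since a chain
  is bounded below by its pointwise infimum; minimality then forces linearity.\<close>

lemma linear_below_sublinear:
  fixes p :: "'a::real_vector \<Rightarrow> real"
  assumes p: "sublinear p"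
  obtains f where "linear f" "\<And>x. f x \<le> p x"
proof -
  define A where "A = {q. sublinear q \<and> (\<forall>x. q x \<le> p x)}"
  let ?P = "\<lambda>a b :: 'a \<Rightarrow> real. \<forall>x. b x \<le> a x"
  have "\<exists>m\<in>A. \<forall>a\<in>A. ?P m a \<longrightarrow> a = m"
  proof (rule predicate_Zorn)
    show "partial_order_on A (relation_of ?P A)"
    proof (rule partial_order_on_relation_ofI)
      show "?P a c" if "?P a b" "?P b c" for a b c
        using that order_trans by blast
      show "a = b" if "?P a b" "?P b a" for a b
        using that by (intro ext antisym) auto
    qed simp
  next
    fix C assume C: "C \<in> Chains (relation_of ?P A)"
    then have CA: "C \<subseteq> A" unfolding Chains_def relation_of_def by blast
    have tot: "?P a b \<or> ?P b a" if "a \<in> C" "b \<in> C" for a b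
      using C that unfolding Chains_def relation_of_def by blast
    show "\<exists>u\<in>A. \<forall>a\<in>C. ?P a u"
    proof (cases "C = {}")
      case True
      then show ?thesis using p by (auto simp: A_def)
    next
      case False
      define u where "u x = (INF q\<in>C. q x)" for x
      have bdd: "bdd_below ((\<lambda>q. q x) ` C)" for x
      proof (rule bdd_belowI2[where m = "- p (- x)"])
        fix q assume "q \<in> C"
        with CA have "sublinear q" "q (- x) \<le> p (- x)" by (auto simp: A_def)
        with sublinear_ge_minus[of q x] show "- p (- x) \<le> q x" by linarith
      qed
      have lower: "u x \<le> q x" if "q \<in> C" for q x
        unfolding u_def by (intro cINF_lower bdd that)
      have greatest: "c \<le> u x" if "\<And>q. q \<in> C \<Longrightarrow> c \<le> q x" for c x
        unfolding u_def using False by (intro cINF_greatest that)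
      have add: "u (x + z) \<le> u x + u z" for x z
      proof -
        have "u (x + z) - q x \<le> r z" if qr: "q \<in> C" "r \<in> C" for q r
        proof -
          \<comment> \<open>Of two comparable functionals the smaller one undercuts both, so its
            subadditivity passes to the infimum.\<close>
          obtain s where s: "s \<in> C" "s x \<le> q x" "s z \<le> r z"
            using tot[OF qr] qr by blast
          from s(1) have "u (x + z) \<le> s (x + z)" by (intro lower)
          also have "\<dots> \<le> s x + s z" using s CA by (auto simp: A_def sublinear_def)
          finally show ?thesis using s by linarith
        qed
        then have "u (x + z) - q x \<le> u z" if "q \<in> C" for q
          using that by (intro greatest) auto
        then have "u (x + z) - u z \<le> u x" by (intro greatest) (simp add: algebra_simps)
        then show ?thesis by simp
      qed
      have hom: "u (t *\<^sub>R x) = t * u x" if "t \<ge> 0" for t x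
      proof (cases "t = 0")
        case True
        have "u 0 = (INF q\<in>C. 0)"
          unfolding u_def using CA by (intro INF_cong) (auto simp: A_def sublinear_zero)
        then show ?thesis using True False by simp
      next
        case False
        with that have t: "t > 0" by simp
        have *: "s * u y \<le> u (s *\<^sub>R y)" if "s > 0" for s y
        proof (rule greatest)
          fix q assume q: "q \<in> C"
          then have "q (s *\<^sub>R y) = s * q y" using CA that by (auto simp: A_def sublinear_def)
          then show "s * u y \<le> q (s *\<^sub>R y)" using lower[OF q, of y] that by simp
        qed
        from *[of "inverse t" "t *\<^sub>R x"] have "u (t *\<^sub>R x) \<le> t * u x"
          using t by (simp add: field_simps)
        with *[OF t] show ?thesis by (simp add: antisym)
      qed
      obtain q0 where "q0 \<in> C" using False by blast
      then have "u x \<le> p x" for x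
        using lower[of q0 x] subsetD[OF CA, of q0] order_trans[of "u x" "q0 x" "p x"]
        by (simp add: A_def)
      with add hom have "u \<in> A" by (auto simp: A_def sublinear_def)
      then show ?thesis using lower by blast
    qed
  qed
  then obtain f where fA: "f \<in> A" and min: "\<And>a. a \<in> A \<Longrightarrow> (\<And>x. a x \<le> f x) \<Longrightarrow> a = f" by blast
  then have f: "sublinear f" and fp: "\<And>x. f x \<le> p x" by (auto simp: A_def)
  have add: "f (x + y) = f x + f y" for x y
  proof -
    \<comment> \<open>Lowering along \<open>y\<close> cannot change the minimal \<open>f\<close>, so
      the last bound on \<open>q\<close> turns into superadditivity of \<open>f\<close>.\<close>
    obtain q where q: "sublinear q" "\<And>x. q x \<le> f x" "\<And>x. q x \<le> f (x + y) - f y"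
      using sublinear_lower[OF f, of y] by blast
    then have "q \<in> A" using fp by (auto simp: A_def intro: order_trans)
    then have "q = f" using q(2) by (rule min)
    then have "f x + f y \<le> f (x + y)" using q(3)[of x] by simp
    then show ?thesis using f unfolding sublinear_def by (simp add: antisym)
  qed
  have neg: "f (- x) = - f x" for x
    using add[of x "- x"] sublinear_zero[OF f] by simp
  have hom: "f (t *\<^sub>R x) = t * f x" for t x
  proof (cases "t \<ge> 0")
    case False
    with f have "f ((- t) *\<^sub>R x) = - t * f x"
      unfolding sublinear_def by (metis linear neg_0_le_iff_le)
    then show ?thesis using neg[of "t *\<^sub>R x"] by simp
  qed (use f in \<open>simp add: sublinear_def\<close>)
  have "linear f" by (rule linearI) (auto simp: add hom)
  then show ?thesis using that fp by blast
qed

text \<open>Lowering the norm along \<open>y\<close> before choosing \<open>f\<close> forces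
  \<open>f (- y) \<le> - norm y\<close>, hence equality at \<open>y\<close>.\<close>

lemma real_norming_functional:
  fixes y :: "'a::real_normed_vector"
  obtains f where "linear f" "\<And>x. f x \<le> norm x" "f y = norm y"
proof -
  have "sublinear (norm :: 'a \<Rightarrow> real)"
    by (auto simp: sublinear_def norm_triangle_ineq)
  then obtain q where q: "sublinear q" "\<And>x. q x \<le> norm x" "\<And>x. q x \<le> norm (x + y) - norm y"
    using sublinear_lower[of norm y] by blast
  obtain f where f: "linear f" "\<And>x. f x \<le> q x" using linear_below_sublinear[OF q(1)] by blast
  have "f (- y) \<le> - norm y" using f(2)[of "- y"] q(3)[of "- y"] by simp
  then have "f y = norm y" using f(2)[of y] q(2)[of y] linear_neg[OF f(1), of y] by simp
  then show ?thesis using that f q(2) order_trans by blast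
qed

text \<open>A real norming functional \<open>u\<close> becomes the real part of a complex one;
  rotating a value onto the positive axis reduces the bound on its modulus to the bound on
  \<open>u\<close>.\<close>

lemma norming_functional:
  fixes y :: "'a::complex_normed_vector"
  obtains f where "cfunctional f" "\<And>x. cmod (f x) \<le> norm x" "cmod (f y) = norm y"
proof -
  obtain u where u: "linear u" "\<And>x. u x \<le> norm x" "u y = norm y"
    using real_norming_functional by blast
  define f where "f x = Complex (u x) (- u (\<i> *\<^sub>C x))" for x
  interpret sc: bounded_linear "\<lambda>x::'a. \<i> *\<^sub>C x" by (rule bounded_linear_scaleC_right)
  have u_add: "u (a + b) = u a + u b" and u_scale: "u (r *\<^sub>R a) = r * u a" for a b r
    using u(1) by (simp_all add: linear_add linear_scale)
  have add: "f (a + b) = f a + f b" for a b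
    by (simp add: f_def complex_eq_iff u_add scaleC_add_right)
  have hom: "f (c *\<^sub>C x) = c * f x" for c x
  proof -
    have c: "c = complex_of_real (Re c) + complex_of_real (Im c) * \<i>"
      by (simp add: complex_eq_iff)
    have 1: "c *\<^sub>C x = Re c *\<^sub>R x + Im c *\<^sub>R (\<i> *\<^sub>C x)"
      unfolding scaleC_of_real[symmetric] scaleC_scaleC scaleC_add_left[symmetric] c[symmetric] ..
    have 2: "\<i> *\<^sub>C (c *\<^sub>C x) = Re c *\<^sub>R (\<i> *\<^sub>C x) + Im c *\<^sub>R (- x)"
    proof -
      have "\<i> *\<^sub>C (\<i> *\<^sub>C x) = - x"
        using scaleC_of_real[of "-1" x] by (simp add: scaleC_scaleC)
      then show ?thesis unfolding 1 by (simp add: sc.add sc.scaleR)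
    qed
    have um: "u (- x) = - u x" using u(1) by (rule linear_neg)
    show ?thesis unfolding f_def 2 unfolding 1 u_add u_scale um
      by (simp add: complex_eq_iff algebra_simps)
  qed
  have bound: "cmod (f x) \<le> norm x" for x
  proof (cases "f x = 0")
    case False
    \<comment> \<open>A unimodular factor that turns the value at \<open>x\<close> into its
      modulus.\<close>
    define c where "c = cnj (f x) / cmod (f x)"
    have "f (c *\<^sub>C x) = cmod (f x)"
    proof -
      have "cnj (f x) * f x = complex_of_real (cmod (f x)) * complex_of_real (cmod (f x))"
        using complex_norm_square[of "f x"] by (simp add: mult.commute power2_eq_square)
      then show ?thesis using False by (simp add: hom c_def divide_simps)
    qed
    then have "cmod (f x) = u (c *\<^sub>C x)" by (simp add: f_def complex_eq_iff)
    also have "\<dots> \<le> norm (c *\<^sub>C x)" by (rule u(2))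
    also have "\<dots> = norm x" using False by (simp add: norm_scaleC c_def norm_divide)
    finally show ?thesis .
  qed simp
  have "f (r *\<^sub>R x) = r *\<^sub>R f x" for r x
    using hom[of "complex_of_real r" x] by (simp add: scaleC_of_real scaleR_conv_of_real)
  then have "bounded_linear f" using add bound by (intro bounded_linear_intro[where K=1]) auto
  moreover have "cmod (f y) = norm y"
    using bound[of y] complex_Re_le_cmod[of "f y"] u(3) by (simp add: f_def)
  ultimately show ?thesis using that hom bound by (auto simp: cfunctional_def)
qed

section \<open>Resolvents near the boundary of the spectrum\<close>

text \<open>By Baire, one of the closed sets \<open>G k\<close> contains a ball; differences of
  values on this ball control all \<open>f i\<close> near 0.\<close>

lemma uniform_boundedness:
  fixes f :: "'i \<Rightarrow> 'a::banach \<Rightarrow> 'b::real_normed_vector"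
  assumes lin: "\<And>i. bounded_linear (f i)"
    and bdd: "\<And>x. \<exists>B. \<forall>i. norm (f i x) \<le> B"
  obtains C where "C > 0" "\<And>i x. norm (f i x) \<le> C * norm x"
proof -
  define G where "G k = {x. \<forall>i. norm (f i x) \<le> real k}" for k :: nat
  have cl: "closed (G k)" for k
  proof -
    have "G k = (\<Inter>i. {x. norm (f i x) \<le> real k})" by (auto simp: G_def)
    also have "closed \<dots>"
    proof (intro closed_INT ballI)
      fix i
      have "continuous_on UNIV (\<lambda>x. norm (f i x))"
        using lin[of i] by (intro continuous_on_norm linear_continuous_on)
      then show "closed {x. norm (f i x) \<le> real k}"
        by (rule closed_Collect_le) (rule continuous_on_const)
    qed
    finally show ?thesis .
  qed
  have "\<Union> (range G) = UNIV"
  proof -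
    have "\<exists>k. x \<in> G k" for x
    proof -
      obtain B where B: "\<forall>i. norm (f i x) \<le> B" using bdd by blast
      obtain k where "B \<le> real k" using real_arch_simple by blast
      then show ?thesis using B order_trans unfolding G_def by blast
    qed
    then show ?thesis by blast
  qed
  then have ne: "euclidean interior_of \<Union> (range G) \<noteq> {}" by simp
  have "\<not> (\<forall>k. interior (G k) = {})"
  proof
    assume "\<forall>k. interior (G k) = {}"
    then have "closedin euclidean X \<and> euclidean interior_of X = {}" if "X \<in> range G" for X
      using that cl by auto
    then have "euclidean interior_of \<Union> (range G) = {}"
      by (intro Baire_category_alt disjI1 completely_metrizable_space_euclidean) auto
    with ne show False ..
  qed
  then obtain k a where "a \<in> interior (G k)" by blast
  then obtain r where r: "r > 0" "cball a r \<subseteq> G k"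
    by (meson mem_interior_cball)
  \<comment> \<open>The factor 2 pays for the values at \<open>a + y\<close> and \<open>a\<close>,
    the division by \<open>r\<close> undoes the scaling of \<open>x\<close> to norm
    \<open>r\<close>, and the summand 1 keeps \<open>C\<close> positive when
    \<open>k = 0\<close>.\<close>
  define C where "C = 2 * (real k + 1) / r"
  have "norm (f i x) \<le> C * norm x" for i x
  proof (cases "x = 0")
    case True
    then show ?thesis by (simp add: lin[THEN bounded_linear.linear, THEN linear_0])
  next
    case False
    interpret f: bounded_linear "f i" by (rule lin)
    define y where "y = (r / norm x) *\<^sub>R x"
    have "norm y = r" using False r by (simp add: y_def)
    then have "a + y \<in> G k" "a \<in> G k" using r by (auto simp: dist_norm)
    then have "norm (f i (a + y) - f i a) \<le> real k + real k"
      unfolding G_def by (intro norm_triangle_le_diff add_mono) auto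
    then have "norm (f i y) \<le> 2 * real k" by (simp add: f.add)
    then have "(r / norm x) * norm (f i x) \<le> 2 * real k"
      using r by (simp add: y_def f.scaleR)
    then have "(r / norm x) * norm (f i x) \<le> 2 * (real k + 1)" by simp
    then show ?thesis using False r by (simp add: C_def field_simps)
  qed
  moreover have "C > 0" using r by (simp add: C_def)
  ultimately show ?thesis using that by blast
qed

section \<open>Perturbation and blow-up of resolvents\<close>

lemma bounded_clinear_scaleC: "bounded_clinear S \<Longrightarrow> S (c *\<^sub>C x) = c *\<^sub>C S x"
  by (simp add: bounded_clinear_def)

lemma bounded_clinear_bounded_linear: "bounded_clinear S \<Longrightarrow> bounded_linear S"
  by (simp add: bounded_clinear_def)

definition resolvent_at :: "('a::complex_normed_vector \<Rightarrow> 'a) \<Rightarrow> complex \<Rightarrow> ('a \<Rightarrow> 'a) \<Rightarrow> bool"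
  where "resolvent_at T z S \<longleftrightarrow> bounded_clinear S \<and>
    (\<forall>x. S (T x - z *\<^sub>C x) = x) \<and> (\<forall>x. T (S x) - z *\<^sub>C S x = x)"

lemma not_in_spectrum_iff: "z \<notin> spectrum T \<longleftrightarrow> (\<exists>S. resolvent_at T z S)"
  by (auto simp: spectrum_def resolvent_at_def)

text \<open>Solving \<open>T x - z *\<^sub>C x = y\<close> is a fixed-point problem for the
  contraction sending x to \<open>S y + (z - l) *\<^sub>C S x\<close>. In contrapositive form, a
  resolvent taken close to the spectrum has large norm.\<close>

lemma resolvent_at_perturb:
  fixes T :: "'a::complex_banach \<Rightarrow> 'a"
  assumes T: "bounded_clinear T" and S: "resolvent_at T l S"
    and C: "\<And>x. norm (S x) \<le> C * norm x" and small: "cmod (z - l) * C < 1" and "C \<ge> 0"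
  shows "z \<notin> spectrum T"
proof -
  interpret T: bounded_linear T using T by (rule bounded_clinear_bounded_linear)
  have Sc: "bounded_clinear S" and Sl: "\<And>x. S (T x - l *\<^sub>C x) = x" and Sr: "\<And>x. T (S x) - l *\<^sub>C S x = x"
    using S by (auto simp: resolvent_at_def)
  interpret S: bounded_linear S using Sc by (rule bounded_clinear_bounded_linear)
  define r where "r = cmod (z - l) * C"
  have r: "0 \<le> r" "r < 1" using small \<open>C \<ge> 0\<close> by (auto simp: r_def)
  have iff: "T x - z *\<^sub>C x = y \<longleftrightarrow> S y + (z - l) *\<^sub>C S x = x" for x y
  proof -
    have split: "T x - z *\<^sub>C x = (T x - l *\<^sub>C x) - (z - l) *\<^sub>C x"
      by (simp add: complex_vector.scale_left_diff_distrib)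
    have comb: "S (y + (z - l) *\<^sub>C x) = S y + (z - l) *\<^sub>C S x"
      by (simp add: S.add bounded_clinear_scaleC[OF Sc])
    show ?thesis
    proof
      assume "T x - z *\<^sub>C x = y"
      then have "y + (z - l) *\<^sub>C x = T x - l *\<^sub>C x"
        unfolding split by (simp add: algebra_simps)
      then show "S y + (z - l) *\<^sub>C S x = x" using Sl[of x] comb by simp
    next
      assume "S y + (z - l) *\<^sub>C S x = x"
      then have "T x - l *\<^sub>C x = y + (z - l) *\<^sub>C x" using Sr[of "y + (z - l) *\<^sub>C x"] comb by simp
      then show "T x - z *\<^sub>C x = y" using split by simp
    qed
  qed
  have ex1: "\<exists>!x. T x - z *\<^sub>C x = y" for y
    unfolding iff
  proof (rule banach_fix_type[OF r], intro allI)
    fix a b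
    have "dist (S y + (z - l) *\<^sub>C S a) (S y + (z - l) *\<^sub>C S b) = cmod (z - l) * norm (S (a - b))"
      by (simp add: dist_norm S.diff norm_scaleC flip: complex_vector.scale_right_diff_distrib)
    also have "\<dots> \<le> cmod (z - l) * (C * norm (a - b))" by (intro mult_left_mono C) auto
    finally show "dist (S y + (z - l) *\<^sub>C S a) (S y + (z - l) *\<^sub>C S b) \<le> r * dist a b"
      by (simp add: r_def dist_norm mult.assoc)
  qed
  define R where "R y = (THE x. T x - z *\<^sub>C x = y)" for y
  have R: "T (R y) - z *\<^sub>C R y = y" for y
    unfolding R_def by (rule theI'[OF ex1])
  have R_unique: "T x - z *\<^sub>C x = y \<Longrightarrow> R y = x" for x y
    using ex1 R by blast
  have bound: "norm (R y) \<le> norm y * (C / (1 - r))" for y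
  proof -
    have "R y = S y + (z - l) *\<^sub>C S (R y)" using R[of y] iff by metis
    then have "norm (R y) \<le> norm (S y) + cmod (z - l) * norm (S (R y))"
      by (metis norm_triangle_ineq norm_scaleC)
    also have "\<dots> \<le> C * norm y + cmod (z - l) * (C * norm (R y))"
      by (intro add_mono mult_left_mono C) auto
    finally have "norm (R y) * (1 - r) \<le> C * norm y" by (simp add: r_def algebra_simps)
    then show ?thesis using r by (simp add: field_simps)
  qed
  have R_scale: "R (c *\<^sub>C y) = c *\<^sub>C R y" for c y
  proof (rule R_unique)
    have "c *\<^sub>C (T (R y) - z *\<^sub>C R y) = c *\<^sub>C y" by (simp only: R)
    then show "T (c *\<^sub>C R y) - z *\<^sub>C c *\<^sub>C R y = c *\<^sub>C y"
      by (simp add: bounded_clinear_scaleC[OF T] scaleC_scaleC mult.commute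
          complex_vector.scale_right_diff_distrib)
  qed
  have R_add: "R (x + y) = R x + R y" for x y
  proof (rule R_unique)
    show "T (R x + R y) - z *\<^sub>C (R x + R y) = x + y"
      using R[of x] R[of y] by (simp add: T.add scaleC_add_right algebra_simps)
  qed
  have "R (t *\<^sub>R x) = t *\<^sub>R R x" for t x
    using R_scale[of "complex_of_real t" x] by (simp add: scaleC_of_real)
  then have "bounded_linear R" using R_add bound by (intro bounded_linear_intro[where K = "C / (1 - r)"]) auto
  then have "bounded_clinear R" using R_scale by (simp add: bounded_clinear_def)
  then have "resolvent_at T z R" using R R_unique by (auto simp: resolvent_at_def)
  then show ?thesis using not_in_spectrum_iff by blast
qed

text \<open>If every vector had a bounded orbit under the resolvents, these would be uniformly
  bounded, and perturbation would clear a disc of fixed radius around each \<open>l n\<close> of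
  spectrum, although \<open>\<mu>\<close> lies in the closure of the spectrum and is the limit of
  \<open>l\<close>.\<close>

lemma unbounded_resolvent_orbit:
  fixes T :: "'a::complex_banach \<Rightarrow> 'a"
  assumes T: "bounded_clinear T" and mu: "\<mu> \<in> frontier (spectrum T)"
  obtains e l S where "e \<noteq> 0" "l \<longlonglongrightarrow> \<mu>" "\<And>n. resolvent_at T (l n) (S n)"
    "filterlim (\<lambda>n. norm (S n e)) at_top sequentially"
proof -
  have "\<mu> \<in> closure (- spectrum T)" and cl: "\<mu> \<in> closure (spectrum T)"
    using mu by (auto simp: frontier_closures)
  then obtain l where l: "\<And>n. l n \<in> - spectrum T" "l \<longlonglongrightarrow> \<mu>"
    unfolding closure_sequential by blast
  then have "\<forall>n. \<exists>S. resolvent_at T (l n) S" using not_in_spectrum_iff by auto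
  then obtain S where S: "\<And>n. resolvent_at T (l n) (S n)" by metis
  have Sb: "bounded_linear (S n)" for n
    using S by (simp add: resolvent_at_def bounded_clinear_def)
  have "\<exists>e. \<forall>B. \<exists>n. norm (S n e) > B"
  proof (rule ccontr)
    assume "\<nexists>e. \<forall>B. \<exists>n. norm (S n e) > B"
    then have "\<exists>B. \<forall>n. norm (S n e) \<le> B" for e by (meson not_le)
    then obtain C where C: "C > 0" "\<And>n x. norm (S n x) \<le> C * norm x"
      using uniform_boundedness[of S] Sb by blast
    \<comment> \<open>Two points within \<open>d\<close> of \<open>\<mu>\<close> are less than
      \<open>2 * d = 1 / C\<close> apart, which is the radius of the perturbation argument.\<close>
    define d where "d = 1 / (2 * C)"
    have d: "d > 0" using C by (simp add: d_def)
    obtain z where z: "z \<in> spectrum T" "dist z \<mu> < d"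
      using cl d unfolding closure_approachable by blast
    have "\<forall>\<^sub>F n in sequentially. dist (l n) \<mu> < d" using l(2) d by (rule tendstoD)
    then obtain n where "dist (l n) \<mu> < d" using eventually_happens by force
    then have "cmod (z - l n) < d + d"
      using z(2) dist_triangle2[of z "l n" \<mu>] by (simp add: dist_norm)
    then have "cmod (z - l n) * C < 1" using C by (simp add: d_def field_simps)
    then have "z \<notin> spectrum T" using resolvent_at_perturb[OF T S C(2)] C(1) by simp
    with z show False by simp
  qed
  then obtain e where e: "\<And>B. \<exists>n. norm (S n e) > B" by blast
  \<comment> \<open>Exceeding all norms up to \<open>k\<close> forces the chosen index
    \<open>h k\<close> beyond \<open>k\<close>, so \<open>l \<circ> h\<close> still tends to
    \<open>\<mu>\<close>; the extra \<open>real k\<close> makes the chosen norms diverge.\<close>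
  have "\<exists>n. \<forall>i\<le>k. norm (S n e) > norm (S i e) + real k" for k
  proof -
    obtain n where n: "norm (S n e) > (\<Sum>i\<le>k. norm (S i e)) + real k" using e by blast
    have "norm (S i e) \<le> (\<Sum>i\<le>k. norm (S i e))" if "i \<le> k" for i
      using that by (intro member_le_sum) auto
    with n show ?thesis by (intro exI[of _ n]) force
  qed
  then obtain h where h: "\<And>k i. i \<le> k \<Longrightarrow> norm (S (h k) e) > norm (S i e) + real k" by metis
  have hk: "h k > k" for k
  proof (rule ccontr)
    assume "\<not> h k > k"
    then have "h k \<le> k" by simp
    from h[OF this] show False by simp
  qed
  have h_inf: "filterlim h at_top sequentially"
    by (rule filterlim_at_top_mono[OF filterlim_ident]) (auto intro!: always_eventually less_imp_le hk)
  show thesis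
  proof (rule that[of e "l \<circ> h" "S \<circ> h"])
    show "e \<noteq> 0"
      using h[of 0 0] Sb[THEN bounded_linear.linear, THEN linear_0] by fastforce
    show "(l \<circ> h) \<longlonglongrightarrow> \<mu>"
      unfolding o_def by (rule filterlim_compose[OF l(2) h_inf])
    show "filterlim (\<lambda>n. norm ((S \<circ> h) n e)) at_top sequentially"
    proof (rule filterlim_at_top_mono[OF filterlim_real_sequentially])
      show "\<forall>\<^sub>F k in sequentially. real k \<le> norm ((S \<circ> h) k e)"
      proof (intro always_eventually allI)
        fix k
        show "real k \<le> norm ((S \<circ> h) k e)"
          using h[of 0 k] norm_ge_zero[of "S 0 e"] unfolding o_def by linarith
      qed
    qed
  qed (simp add: S)
qed

text \<open>The equation \<open>T (S n e) = l n *\<^sub>C S n e + e\<close>, divided by the norm of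
  \<open>S n e\<close>, leaves a multiple of \<open>e\<close> that tends to 0.\<close>

lemma normalized_resolvent_vectors:
  fixes T :: "'a::complex_banach \<Rightarrow> 'a"
  assumes T: "bounded_clinear T" and mu: "\<mu> \<in> frontier (spectrum T)"
  obtains e x l c where "e \<noteq> 0" "\<And>n::nat. norm (x n) = 1" "\<And>n. c n \<noteq> 0"
    "\<And>n. T (x n) = l n *\<^sub>C x n + c n *\<^sub>C e" "(\<lambda>n. T (x n) - \<mu> *\<^sub>C x n) \<longlonglongrightarrow> 0"
proof -
  obtain e l S where e: "e \<noteq> 0" and l: "l \<longlonglongrightarrow> \<mu>" and S: "\<And>n. resolvent_at T (l n) (S n)"
    and inf: "filterlim (\<lambda>n. norm (S n e)) at_top sequentially"
    using unbounded_resolvent_orbit[OF T mu] by blast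
  interpret T: bounded_linear T using T by (rule bounded_clinear_bounded_linear)
  have nz: "norm (S n e) \<noteq> 0" for n
  proof
    assume "norm (S n e) = 0"
    then have "e = 0" using S[of n] unfolding resolvent_at_def
      by (metis T.zero complex_vector.scale_zero_right diff_zero norm_eq_zero)
    with e show False ..
  qed
  define c where "c n = complex_of_real (inverse (norm (S n e)))" for n
  define x where "x n = c n *\<^sub>C S n e" for n
  have nx: "norm (x n) = 1" for n
    using nz[of n] by (simp add: x_def c_def norm_scaleC norm_inverse)
  have Tx: "T (x n) = l n *\<^sub>C x n + c n *\<^sub>C e" for n
  proof -
    have "T (S n e) = l n *\<^sub>C S n e + e"
      using S[of n] unfolding resolvent_at_def by (metis add.commute diff_add_cancel)
    then show ?thesis
      by (simp add: x_def bounded_clinear_scaleC[OF T] scaleC_add_right scaleC_scaleC mult.commute)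
  qed
  have "c \<longlonglongrightarrow> complex_of_real 0"
    unfolding c_def by (intro tendsto_of_real filterlim_compose[OF tendsto_inverse_0_at_top inf] tendsto_inverse_0_at_top inf)
  then have "(\<lambda>n. cmod (l n - \<mu>) + cmod (c n) * norm e) \<longlonglongrightarrow> cmod (\<mu> - \<mu>) + cmod (complex_of_real 0) * norm e"
    by (intro tendsto_intros l)
  then have lim: "(\<lambda>n. cmod (l n - \<mu>) + cmod (c n) * norm e) \<longlonglongrightarrow> 0" by simp
  have "(\<lambda>n. T (x n) - \<mu> *\<^sub>C x n) \<longlonglongrightarrow> 0"
  proof (rule Lim_null_comparison[OF _ lim], intro always_eventually allI)
    fix n
    have "T (x n) - \<mu> *\<^sub>C x n = (l n - \<mu>) *\<^sub>C x n + c n *\<^sub>C e"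
      by (simp add: Tx complex_vector.scale_left_diff_distrib)
    then show "norm (T (x n) - \<mu> *\<^sub>C x n) \<le> cmod (l n - \<mu>) + cmod (c n) * norm e"
      using norm_triangle_ineq[of "(l n - \<mu>) *\<^sub>C x n" "c n *\<^sub>C e"] by (simp add: norm_scaleC nx)
  qed
  moreover have "c n \<noteq> 0" for n using nz[of n] by (simp add: c_def)
  ultimately show thesis using that[of e x c l] e nx Tx by blast
qed

section \<open>Minimal sequences\<close>

text \<open>The coefficient functionals of \<open>v\<close> are bounded on its span, with no uniformity in the index.\<close>

definition minimal_sequence :: "(nat \<Rightarrow> 'a::complex_normed_vector) \<Rightarrow> bool"
  where "minimal_sequence v \<longleftrightarrow>
    (\<forall>j. \<exists>L. \<forall>m a. j < m \<longrightarrow> cmod (a j) \<le> L * norm (\<Sum>k<m. a k *\<^sub>C v k))"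

text \<open>The approximate eigenvectors are only known to cluster at 0 against functionals of a
  restricted set \<open>W\<close>, so Mazur's construction is run in the norm induced by
  \<open>W\<close>.\<close>

locale norming_set =
  fixes W :: "('a::complex_normed_vector \<Rightarrow> complex) set" and c :: real
  assumes c_pos: "c > 0"
    and W_functional: "f \<in> W \<Longrightarrow> cfunctional f"
    and W_bound: "f \<in> W \<Longrightarrow> cmod (f y) \<le> norm y"
    and W_norming: "\<exists>f\<in>W. c * norm y \<le> cmod (f y)"
begin

section \<open>The equivalent norm of a norming set\<close>

definition q :: "'a \<Rightarrow> real" where "q y = (SUP f\<in>W. cmod (f y))"

lemma W_nonempty: "W \<noteq> {}"
  using W_norming by blast

lemma q_upper: "f \<in> W \<Longrightarrow> cmod (f y) \<le> q y"
  unfolding q_def by (rule cSUP_upper) (auto intro!: bdd_aboveI2[where M = "norm y"] W_bound)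

lemma q_least: "(\<And>f. f \<in> W \<Longrightarrow> cmod (f y) \<le> M) \<Longrightarrow> q y \<le> M"
  unfolding q_def by (rule cSUP_least[OF W_nonempty])

lemma q_le_norm: "q y \<le> norm y"
  by (rule q_least) (rule W_bound)

lemma q_ge_norm: "c * norm y \<le> q y"
  using W_norming[of y] q_upper order_trans by blast

lemma q_nonneg: "q y \<ge> 0"
  using q_ge_norm[of y] c_pos by (meson mult_nonneg_nonneg norm_ge_zero less_imp_le order_trans)

lemma q_pos: "y \<noteq> 0 \<Longrightarrow> q y > 0"
  using q_ge_norm[of y] c_pos by (meson mult_pos_pos zero_less_norm_iff less_le_trans)

lemma q_zero [simp]: "q 0 = 0"
  using q_le_norm[of 0] q_nonneg[of 0] by simp

lemma q_triangle: "q (y + z) \<le> q y + q z"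
proof (rule q_least)
  fix f assume f: "f \<in> W"
  then have "cmod (f (y + z)) \<le> cmod (f y) + cmod (f z)"
    unfolding cfunctional_add[OF W_functional[OF f]] by (intro norm_triangle_ineq)
  also have "\<dots> \<le> q y + q z" using f by (intro add_mono q_upper)
  finally show "cmod (f (y + z)) \<le> q y + q z" .
qed

lemma q_scaleC_le: "q (a *\<^sub>C y) \<le> cmod a * q y"
proof (rule q_least)
  fix f assume f: "f \<in> W"
  then have "cmod (f (a *\<^sub>C y)) = cmod a * cmod (f y)"
    unfolding cfunctional_scaleC[OF W_functional[OF f]] by (intro norm_mult)
  then show "cmod (f (a *\<^sub>C y)) \<le> cmod a * q y"
    using q_upper[OF f] by (simp add: mult_left_mono)
qed

lemma q_scaleC: "q (a *\<^sub>C y) = cmod a * q y"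
proof (cases "a = 0")
  case False
  have "q y = q (inverse a *\<^sub>C (a *\<^sub>C y))" using False by (simp add: scaleC_scaleC)
  also have "\<dots> \<le> cmod (inverse a) * q (a *\<^sub>C y)" by (rule q_scaleC_le)
  finally have "cmod a * q y \<le> q (a *\<^sub>C y)" using False unfolding norm_inverse
    by (simp add: divide_simps mult.commute)
  with q_scaleC_le show ?thesis by (rule antisym)
qed simp

lemma q_minus: "q (- y) = q y"
  using q_scaleC[of "-1" y] by simp

lemma q_diff: "q (y - z) \<le> q y + q z"
  using q_triangle[of y "- z"] by (simp add: q_minus)

lemma continuous_on_q: "continuous_on S q"
proof -
  have "1-lipschitz_on UNIV q"
  proof (rule lipschitz_onI)
    fix y z
    have "q y \<le> q (y - z) + q z" "q z \<le> q (y - z) + q y"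
      using q_triangle[of "y - z" z] q_triangle[of "z - y" y] q_minus[of "y - z"] by auto
    then show "dist (q y) (q z) \<le> 1 * dist y z"
      using q_le_norm[of "y - z"] by (simp add: dist_norm)
  qed simp
  then show ?thesis by (rule continuous_on_subset[OF lipschitz_on_continuous_on]) simp
qed

text \<open>The coefficient bound places the \<open>q\<close>-unit sphere of the span in a
  continuous image of a compact product of discs; the open sets where single functionals exceed
  \<open>\<theta>\<close> cover it, so finitely many suffice.\<close>

lemma finite_norming_subset:
  fixes v :: "nat \<Rightarrow> 'a"
  assumes L: "\<And>a j. j < m \<Longrightarrow> cmod (a j) \<le> L * q (\<Sum>k<m. a k *\<^sub>C v k)" and "\<theta> < 1"
  obtains G where "finite G" "G \<subseteq> W"
    "\<forall>a. q (\<Sum>k<m. a k *\<^sub>C v k) = 1 \<longrightarrow> (\<exists>f\<in>G. \<theta> < cmod (f (\<Sum>k<m. a k *\<^sub>C v k)))"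
proof -
  define P where "P = (\<lambda>a. \<Sum>k<m. a k *\<^sub>C v k) ` (PiE UNIV (\<lambda>k. cball 0 L))"
  have "compactin (product_topology (\<lambda>k. euclidean) UNIV) (PiE (UNIV::nat set) (\<lambda>k. cball (0::complex) L))"
    unfolding compactin_PiE by simp
  then have "compact (PiE (UNIV::nat set) (\<lambda>k. cball (0::complex) L))"
    by (simp add: euclidean_product_topology)
  moreover have "continuous_on X (\<lambda>a. \<Sum>k<m. a k *\<^sub>C v k)" for X :: "(nat \<Rightarrow> complex) set"
    by (intro continuous_on_sum bounded_linear.continuous_on[OF bounded_linear_scaleC_left]
        continuous_on_subset[OF continuous_on_product_coordinates]) simp
  ultimately have "compact P" unfolding P_def by (intro compact_continuous_image)
  moreover have "closed {y. q y = 1}"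
    using continuous_on_q by (intro closed_Collect_eq continuous_on_const)
  ultimately have "compact (P \<inter> {y. q y = 1})" by (rule compact_Int_closed)
  moreover have "open {y. \<theta> < cmod (f y)}" if "f \<in> W" for f
    using cfunctional_bounded_linear[OF W_functional[OF that]]
    by (intro open_Collect_less continuous_on_const continuous_on_norm linear_continuous_on)
  moreover have "P \<inter> {y. q y = 1} \<subseteq> (\<Union>f\<in>W. {y. \<theta> < cmod (f y)})"
  proof
    fix y assume "y \<in> P \<inter> {y. q y = 1}"
    then have "\<theta> < q y" using \<open>\<theta> < 1\<close> by simp
    then have "\<exists>f\<in>W. \<theta> < cmod (f y)" using q_least[of y \<theta>] by (meson not_le)
    then show "y \<in> (\<Union>f\<in>W. {y. \<theta> < cmod (f y)})" by blast
  qed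
  ultimately obtain G where G: "G \<subseteq> W" "finite G"
    "P \<inter> {y. q y = 1} \<subseteq> (\<Union>f\<in>G. {y. \<theta> < cmod (f y)})"
    by (rule compactE_image)
  show thesis
  proof (rule that[OF G(2,1)], intro allI impI)
    fix a assume 1: "q (\<Sum>k<m. a k *\<^sub>C v k) = 1"
    \<comment> \<open>The values of \<open>a\<close> from \<open>m\<close> on are arbitrary; setting
      them to 0 moves the sequence into the product of discs and keeps the sum.\<close>
    let ?a = "\<lambda>k. if k < m then a k else 0"
    have eq: "(\<Sum>k<m. ?a k *\<^sub>C v k) = (\<Sum>k<m. a k *\<^sub>C v k)" by (intro sum.cong) auto
    show "\<exists>f\<in>G. \<theta> < cmod (f (\<Sum>k<m. a k *\<^sub>C v k))"
    proof (cases "m = 0")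
      case False
      then have "cmod (a 0) \<le> L" using L[of 0 a] 1 by simp
      then have "0 \<le> L" by (rule order_trans[OF norm_ge_zero])
      then have "(\<Sum>k<m. ?a k *\<^sub>C v k) \<in> P"
        unfolding P_def using L[of _ a] 1 by (intro imageI) auto
      then show ?thesis using G(3) 1 unfolding eq by blast
    qed (use 1 in simp)
  qed
qed

text \<open>Finitely many functionals nearly attain \<open>q\<close> on the unit sphere of the span.
  If they are all small at \<open>x n\<close>, adding a multiple of \<open>x n\<close> cannot cancel
  much of a vector of that sphere.\<close>

lemma mazur_step:
  fixes v :: "nat \<Rightarrow> 'a" and x :: "nat \<Rightarrow> 'a"
  assumes L: "\<And>a j. j < m \<Longrightarrow> cmod (a j) \<le> L * q (\<Sum>k<m. a k *\<^sub>C v k)"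
    and \<theta>: "0 < \<theta>" "\<theta> < 1" and x: "\<And>n. norm (x n) = 1"
    and null: "\<And>G \<eta>. \<lbrakk>finite G; G \<subseteq> W; \<eta> > 0\<rbrakk> \<Longrightarrow> \<exists>n. \<forall>f\<in>G. cmod (f (x n)) < \<eta>"
  obtains n where "\<And>a b. \<theta> * q (\<Sum>k<m. a k *\<^sub>C v k) \<le> q ((\<Sum>k<m. a k *\<^sub>C v k) + b *\<^sub>C x n)"
proof -
  define \<theta>' where "\<theta>' = (1 + \<theta>) / 2"
  have \<theta>': "\<theta> < \<theta>'" "\<theta>' < 1" using \<theta> by (auto simp: \<theta>'_def)
  obtain G where G: "finite G" "G \<subseteq> W"
    "\<forall>a. q (\<Sum>k<m. a k *\<^sub>C v k) = 1 \<longrightarrow> (\<exists>f\<in>G. \<theta>' < cmod (f (\<Sum>k<m. a k *\<^sub>C v k)))"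
    by (rule finite_norming_subset[where m = m and v = v and L = L and \<theta> = \<theta>', OF L \<theta>'(2)])
  \<comment> \<open>Chosen so that \<open>cmod b * \<eta>\<close> stays within the margin
    \<open>\<theta>' - \<theta>\<close> while \<open>cmod b * c < 2\<close>; for larger
    \<open>b\<close> the vector \<open>b *\<^sub>C x n\<close> has \<open>q\<close> at least 2 and
    outweighs the unit vector.\<close>
  define \<eta> where "\<eta> = (\<theta>' - \<theta>) * c / 2"
  have "\<eta> > 0" using \<theta>' c_pos by (simp add: \<eta>_def)
  then obtain n where n: "\<forall>f\<in>G. cmod (f (x n)) < \<eta>" using null[OF G(1,2)] by blast
  have unit: "\<theta> \<le> q (y + b *\<^sub>C x n)" if y: "y = (\<Sum>k<m. a k *\<^sub>C v k)" "q y = 1" for y a b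
  proof (cases "cmod b * c \<ge> 2")
    case True
    have "cmod b * c \<le> cmod b * q (x n)"
      using q_ge_norm[of "x n"] x by (intro mult_left_mono) auto
    then have "2 \<le> q (b *\<^sub>C x n)" using True by (simp add: q_scaleC)
    also have "\<dots> \<le> q (y + b *\<^sub>C x n) + q y" using q_diff[of "y + b *\<^sub>C x n" y] by simp
    finally show ?thesis using y(2) \<theta> by simp
  next
    case False
    obtain f where f: "f \<in> G" "\<theta>' < cmod (f y)" using G(3) y by auto
    then have fW: "f \<in> W" using G by blast
    have "f (y + b *\<^sub>C x n) = f y + b * f (x n)"
      using W_functional[OF fW] by (simp add: cfunctional_add cfunctional_scaleC)
    then have "cmod (f y) - cmod b * cmod (f (x n)) \<le> q (y + b *\<^sub>C x n)"
      using q_upper[OF fW, of "y + b *\<^sub>C x n"] norm_diff_ineq[of "f y" "b * f (x n)"]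
      by (simp add: norm_mult)
    moreover have "cmod b * cmod (f (x n)) \<le> cmod b * \<eta>"
      using bspec[OF n f(1)] by (intro mult_left_mono) auto
    moreover have "cmod b * \<eta> \<le> \<theta>' - \<theta>"
    proof -
      have "(cmod b * c) * ((\<theta>' - \<theta>) / 2) \<le> 2 * ((\<theta>' - \<theta>) / 2)"
        using False \<theta>' by (intro mult_right_mono) auto
      also have "(cmod b * c) * ((\<theta>' - \<theta>) / 2) = cmod b * \<eta>" by (simp add: \<eta>_def)
      finally show ?thesis by simp
    qed
    ultimately show ?thesis using f(2) by linarith
  qed
  have "\<theta> * q (\<Sum>k<m. a k *\<^sub>C v k) \<le> q ((\<Sum>k<m. a k *\<^sub>C v k) + b *\<^sub>C x n)" for a b
  proof -
    let ?s = "\<Sum>k<m. a k *\<^sub>C v k"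
    show ?thesis
    proof (cases "q ?s = 0")
      case False
      define r where "r = complex_of_real (q ?s)"
      have r: "r \<noteq> 0" "cmod r = q ?s" using False q_nonneg[of ?s] by (auto simp: r_def)
      have 1: "inverse r *\<^sub>C ?s = (\<Sum>k<m. (inverse r * a k) *\<^sub>C v k)"
        by (simp add: complex_vector.scale_sum_right scaleC_scaleC)
      have "q (inverse r *\<^sub>C ?s) = 1" using r False by (simp add: q_scaleC norm_inverse)
      then have "\<theta> \<le> q (inverse r *\<^sub>C ?s + (inverse r * b) *\<^sub>C x n)" by (rule unit[OF 1])
      also have "inverse r *\<^sub>C ?s + (inverse r * b) *\<^sub>C x n = inverse r *\<^sub>C (?s + b *\<^sub>C x n)"
        by (simp add: scaleC_add_right scaleC_scaleC)
      finally have "\<theta> \<le> inverse (q ?s) * q (?s + b *\<^sub>C x n)"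
        using r by (simp add: q_scaleC norm_inverse)
      then show ?thesis using False q_nonneg[of ?s] by (simp add: field_simps)
    qed (simp add: q_nonneg)
  qed
  then show thesis using that by blast
qed

text \<open>Mazur's construction of a basic sequence; the constants \<open>K m\<close> increase from 1 to 2.\<close>

lemma minimal_sequence_exists:
  fixes x :: "nat \<Rightarrow> 'a"
  assumes x: "\<And>n. norm (x n) = 1" and e: "e \<noteq> 0"
    and null: "\<And>G \<eta>. \<lbrakk>finite G; G \<subseteq> W; \<eta> > 0\<rbrakk> \<Longrightarrow> \<exists>n. \<forall>f\<in>G. cmod (f (x n)) < \<eta>"
  obtains v where "v 0 = e" "\<And>k. v (Suc k) \<in> range x" "minimal_sequence v"
proof -
  define K :: "nat \<Rightarrow> real" where "K m = 2 - (1/2)^m" for m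
  have K: "1 \<le> K m" "K m < 2" "K m < K (Suc m)" for m
    by (simp_all add: K_def power_le_one)
  \<comment> \<open>\<open>P v m r\<close> admits \<open>r\<close> as term \<open>m\<close> after
    the terms of \<open>v\<close> below \<open>m\<close>: slot 0 is reserved for \<open>e\<close>,
    and the permitted loss in step \<open>m\<close> is the factor
    \<open>K m / K (Suc m)\<close>.\<close>
  define P where "P v m r \<longleftrightarrow> r \<noteq> 0 \<and> (if m = 0 then r = e else r \<in> range x) \<and>
    (\<forall>a b. K m * q (\<Sum>k<m. a k *\<^sub>C v k) \<le> K (Suc m) * q ((\<Sum>k<m. a k *\<^sub>C v k) + b *\<^sub>C r))"
    for v m r
  have P_nz: "P v m r \<Longrightarrow> r \<noteq> 0"
    and P_step: "P v m r \<Longrightarrow> K m * q (\<Sum>k<m. a k *\<^sub>C v k) \<le> K (Suc m) * q ((\<Sum>k<m. a k *\<^sub>C v k) + b *\<^sub>C r)"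
    for v m r a b unfolding P_def by blast+
  \<comment> \<open>The losses telescope to \<open>K m / K j\<close>, which is less than 2.\<close>
  have partial: "q (\<Sum>k<j. a k *\<^sub>C v k) \<le> 2 * q (\<Sum>k<m. a k *\<^sub>C v k)"
    if P: "\<And>i. i < m \<Longrightarrow> P v i (v i)" and "j \<le> m" for v a j m
  proof -
    have "K j * q (\<Sum>k<j. a k *\<^sub>C v k) \<le> K m * q (\<Sum>k<m. a k *\<^sub>C v k)"
      using \<open>j \<le> m\<close> P
    proof (induction m rule: dec_induct)
      case (step i)
      then have "K j * q (\<Sum>k<j. a k *\<^sub>C v k) \<le> K i * q (\<Sum>k<i. a k *\<^sub>C v k)" by simp
      also have "\<dots> \<le> K (Suc i) * q (\<Sum>k<Suc i. a k *\<^sub>C v k)"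
        using P_step[OF step.prems[of i], of a "a i"] by simp
      finally show ?case .
    qed simp
    moreover have "q (\<Sum>k<j. a k *\<^sub>C v k) \<le> K j * q (\<Sum>k<j. a k *\<^sub>C v k)"
      using mult_right_mono[OF K(1)[of j] q_nonneg] by simp
    moreover have "K m * q (\<Sum>k<m. a k *\<^sub>C v k) \<le> 2 * q (\<Sum>k<m. a k *\<^sub>C v k)"
      using K(2)[of m] q_nonneg by (intro mult_right_mono) auto
    ultimately show ?thesis by linarith
  qed
  \<comment> \<open>A single term is the difference of two consecutive partial sums, each at most
    twice the whole sum; hence the 4.\<close>
  have coeff: "cmod (a j) \<le> 4 / q (v j) * q (\<Sum>k<m. a k *\<^sub>C v k)"
    if P: "\<And>i. i < m \<Longrightarrow> P v i (v i)" and "j < m" for v a j m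
  proof -
    have "a j *\<^sub>C v j = (\<Sum>k<Suc j. a k *\<^sub>C v k) - (\<Sum>k<j. a k *\<^sub>C v k)" by simp
    then have "q (a j *\<^sub>C v j) \<le> q (\<Sum>k<Suc j. a k *\<^sub>C v k) + q (\<Sum>k<j. a k *\<^sub>C v k)"
      using q_diff by metis
    also have "\<dots> \<le> 2 * q (\<Sum>k<m. a k *\<^sub>C v k) + 2 * q (\<Sum>k<m. a k *\<^sub>C v k)"
      using \<open>j < m\<close> by (intro add_mono partial P) auto
    finally have "cmod (a j) * q (v j) \<le> 4 * q (\<Sum>k<m. a k *\<^sub>C v k)" by (simp add: q_scaleC)
    moreover have "q (v j) > 0" using P_nz[OF P[OF \<open>j < m\<close>]] by (rule q_pos)
    ultimately show ?thesis by (simp add: field_simps)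
  qed
  have "\<exists>v. \<forall>m. P v m (v m)"
  proof (rule dependent_wellorder_choice)
    \<comment> \<open>The recursive choice requires that \<open>P\<close> sees only the terms before
      \<open>m\<close>.\<close>
    show "P f m r = P g m r" if "\<And>i. i < m \<Longrightarrow> f i = g i" for r f g m
    proof -
      have "(\<Sum>k<m. a k *\<^sub>C f k) = (\<Sum>k<m. a k *\<^sub>C g k)" for a
        using that by (intro sum.cong) auto
      then show ?thesis by (simp add: P_def)
    qed
  next
    fix m v assume P: "\<And>i. i < m \<Longrightarrow> P v i (v i)"
    show "\<exists>r. P v m r"
    proof (cases "m = 0")
      case True
      \<comment> \<open>The empty sum has \<open>q\<close> equal to 0, so any nonzero first term is
        admissible.\<close>
      have "K (Suc 0) \<ge> 0" using K(1)[of "Suc 0"] by linarith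
      then show ?thesis using e True q_nonneg by (auto simp: P_def intro!: exI[of _ e])
    next
      case False
      \<comment> \<open>\<open>mazur_step\<close> takes one constant for all coefficients; the sum
        dominates each of the finitely many individual ones.\<close>
      define L where "L = (\<Sum>j<m. 4 / q (v j))"
      have L: "cmod (a j) \<le> L * q (\<Sum>k<m. a k *\<^sub>C v k)" if "j < m" for a j
      proof -
        have "4 / q (v j) \<le> L"
          unfolding L_def using that q_nonneg by (intro member_le_sum) auto
        then have "4 / q (v j) * q (\<Sum>k<m. a k *\<^sub>C v k) \<le> L * q (\<Sum>k<m. a k *\<^sub>C v k)"
          using q_nonneg by (rule mult_right_mono)
        with coeff[OF P that] show ?thesis by (rule order_trans)
      qed
      have "K (Suc m) > 0" "K m > 0" using K(1)[of "Suc m"] K(1)[of m] by linarith+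
      then have \<theta>: "0 < K m / K (Suc m)" "K m / K (Suc m) < 1" using K(3)[of m] by simp_all
      obtain n where "\<And>a b. K m / K (Suc m) * q (\<Sum>k<m. a k *\<^sub>C v k)
          \<le> q ((\<Sum>k<m. a k *\<^sub>C v k) + b *\<^sub>C x n)"
        using mazur_step[where v = v and x = x, OF L \<theta> x null] by blast
      then have "P v m (x n)"
        using False \<open>K (Suc m) > 0\<close> x[of n] by (auto simp: P_def field_simps)
      then show ?thesis ..
    qed
  qed
  then obtain v where v: "\<And>m. P v m (v m)" by blast
  show thesis
  proof (rule that)
    show "v 0 = e" "v (Suc k) \<in> range x" for k
      using v[of 0] v[of "Suc k"] by (auto simp: P_def)
    have "cmod (a j) \<le> 4 / q (v j) * norm (\<Sum>k<m. a k *\<^sub>C v k)" if "j < m" for a j m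
      using coeff[OF v that, of a] q_le_norm q_nonneg[of "v j"]
      by (meson divide_nonneg_nonneg mult_left_mono order_trans zero_le_numeral)
    then show "minimal_sequence v" unfolding minimal_sequence_def by blast
  qed
qed

end

section \<open>Weak-star cluster points of approximate eigenvectors\<close>

lemma cfunctional_zero: "cfunctional (\<lambda>x. 0)"
  by (simp add: cfunctional_def)

lemma cfunctional_lincomb:
  assumes "cfunctional f" "cfunctional g"
  shows "cfunctional (\<lambda>x. a * f x + b * g x)"
  unfolding cfunctional_def
proof
  show "bounded_linear (\<lambda>x. a * f x + b * g x)"
    using assms[THEN cfunctional_bounded_linear]
    by (intro bounded_linear_add bounded_linear_const_mult)
qed (use assms in \<open>simp add: cfunctional_def algebra_simps\<close>)

text \<open>Banach-Alaoglu by Tychonoff: the evaluations at \<open>x n\<close> lie in a compact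
  product of discs. Allowing any \<open>N\<close> records that the sequence returns to each
  neighbourhood infinitely often.\<close>

lemma functional_cluster_point:
  fixes x :: "nat \<Rightarrow> 'a::complex_normed_vector"
  assumes x: "\<And>n. norm (x n) = 1"
  obtains \<phi> :: "('a \<Rightarrow> complex) \<Rightarrow> complex" where
    "\<And>G \<eta> N. \<lbrakk>finite G; \<And>f. f \<in> G \<Longrightarrow> cfunctional f; \<eta> > 0\<rbrakk> \<Longrightarrow>
       \<exists>n\<ge>N. \<forall>f\<in>G. cmod (f (x n) - \<phi> f) < \<eta>"
proof -
  \<comment> \<open>Maps that are not functionals receive the factor \<open>{0}\<close>, so that the
    product can range over the whole function type.\<close>
  define K where "K f = (if cfunctional f then cball (0::complex) (onorm f) else {0})"
    for f :: "'a \<Rightarrow> complex"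
  define ev where "ev n f = (if cfunctional f then f (x n) else 0)" for n f
  have "compactin (product_topology (\<lambda>f. euclidean) UNIV) (PiE UNIV K)"
    unfolding compactin_PiE by (auto simp: K_def)
  then have comp: "compact (PiE UNIV K)"
    by (simp add: euclidean_product_topology)
  have "ev n \<in> PiE UNIV K" for n
    using onorm[OF cfunctional_bounded_linear, of _ "x n"] x[of n] by (auto simp: ev_def K_def)
  then have "\<forall>\<^sub>F \<psi> in filtermap ev sequentially. \<psi> \<in> PiE UNIV K"
    by (simp add: eventually_filtermap)
  moreover have "filtermap ev sequentially \<noteq> bot"
    by (simp add: filtermap_bot_iff)
  ultimately obtain \<phi> where \<phi>: "inf (nhds \<phi>) (filtermap ev sequentially) \<noteq> bot"
    using comp unfolding compact_filter by blast
  show thesis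
  proof (rule that[of \<phi>])
    fix G :: "('a \<Rightarrow> complex) set" and \<eta> :: real and N :: nat
    assume G: "finite G" "\<And>f. f \<in> G \<Longrightarrow> cfunctional f" and \<eta>: "\<eta> > 0"
    define V where "V = {\<psi>. \<forall>f\<in>G. \<psi> (id f) \<in> ball (\<phi> f) \<eta>}"
    have "open V"
      unfolding V_def by (rule product_topology_basis') (use G in auto)
    moreover have "\<phi> \<in> V" using \<eta> by (simp add: V_def)
    ultimately have "\<forall>\<^sub>F \<psi> in nhds \<phi>. \<psi> \<in> V" by (rule eventually_nhds_in_open)
    moreover have "\<not> (\<forall>\<^sub>F \<psi> in inf (nhds \<phi>) (filtermap ev sequentially). False)"
      using \<phi> by (simp add: eventually_False)
    ultimately have "\<not> (\<forall>\<^sub>F \<psi> in filtermap ev sequentially. \<psi> \<notin> V)"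
      unfolding eventually_inf by blast
    then have "\<exists>n\<ge>N. ev n \<in> V"
      unfolding eventually_filtermap eventually_sequentially by blast
    then show "\<exists>n\<ge>N. \<forall>f\<in>G. cmod (f (x n) - \<phi> f) < \<eta>"
      using G by (auto simp: V_def ev_def dist_norm norm_minus_commute)
  qed
qed

text \<open>Only the values of \<open>\<phi>\<close> at genuine functionals matter; there it is a point of the bidual, the
  weak-star cluster point of \<open>x\<close>. The functionals annihilated by it are still norming, since
  otherwise it would be evaluation at a vector of \<open>ker A\<close>.\<close>

lemma norming_null_functionals:
  fixes x :: "nat \<Rightarrow> 'a::complex_banach"
  assumes x: "\<And>n. norm (x n) = 1" and A: "bounded_clinear A"
    and Ax: "(\<lambda>n. A (x n)) \<longlonglongrightarrow> 0" and inj: "\<And>z. A z = 0 \<Longrightarrow> z = 0"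
  obtains W :: "('a \<Rightarrow> complex) set" and c where "norming_set W c"
    "\<And>G \<eta>. \<lbrakk>finite G; G \<subseteq> W; \<eta> > 0\<rbrakk> \<Longrightarrow> \<exists>n. \<forall>f\<in>G. cmod (f (x n)) < \<eta>"
proof -
  obtain \<phi> :: "('a \<Rightarrow> complex) \<Rightarrow> complex" where \<phi>:
    "\<And>G \<eta> N. \<lbrakk>finite G; \<And>f. f \<in> G \<Longrightarrow> cfunctional f; \<eta> > 0\<rbrakk> \<Longrightarrow>
       \<exists>n\<ge>N. \<forall>f\<in>G. cmod (f (x n) - \<phi> f) < \<eta>"
    using functional_cluster_point[of x] x by blast
  have \<phi>_lincomb: "\<phi> (\<lambda>x. a * f x + b * g x) = a * \<phi> f + b * \<phi> g"
    if fg: "cfunctional f" "cfunctional g" for f g a b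
  proof -
    let ?h = "\<lambda>x. a * f x + b * g x"
    have "cmod (\<phi> ?h - (a * \<phi> f + b * \<phi> g)) \<le> \<epsilon>" if "\<epsilon> > 0" for \<epsilon>
    proof -
      \<comment> \<open>The errors of the three functionals at one common index add up to
        \<open>(1 + cmod a + cmod b) * \<eta>\<close>, which is to equal
        \<open>\<epsilon>\<close>.\<close>
      define \<eta> where "\<eta> = \<epsilon> / (1 + cmod a + cmod b)"
      have pos: "1 + cmod a + cmod b > 0" by (simp add: add_pos_nonneg)
      have \<eta>: "\<eta> > 0" using that pos by (simp add: \<eta>_def)
      obtain n where n: "cmod (f (x n) - \<phi> f) < \<eta>" "cmod (g (x n) - \<phi> g) < \<eta>"
          "cmod (?h (x n) - \<phi> ?h) < \<eta>"
        using \<phi>[of "{f, g, ?h}" \<eta> 0] \<eta> fg cfunctional_lincomb[OF fg, of a b] by auto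
      have "\<phi> ?h - (a * \<phi> f + b * \<phi> g) =
          (a * (f (x n) - \<phi> f) + b * (g (x n) - \<phi> g)) - (?h (x n) - \<phi> ?h)"
        by (simp add: algebra_simps)
      also have "cmod \<dots> \<le> (cmod a * \<eta> + cmod b * \<eta>) + \<eta>"
        using n less_imp_le[OF n(3)] mult_left_mono[OF less_imp_le[OF n(1)], of "cmod a"]
          mult_left_mono[OF less_imp_le[OF n(2)], of "cmod b"]
        by (intro norm_triangle_le_diff[OF add_mono[OF norm_triangle_le[OF add_mono]]])
          (simp_all only: norm_mult norm_ge_zero)
      also have "\<dots> = (1 + cmod a + cmod b) * \<eta>" by (simp add: algebra_simps)
      also have "\<dots> = \<epsilon>" using pos by (simp add: \<eta>_def)
      finally show ?thesis .
    qed
    then have "cmod (\<phi> ?h - (a * \<phi> f + b * \<phi> g)) \<le> 0" by (rule field_le_epsilon[of _ 0, simplified])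
    then show ?thesis by simp
  qed
  have \<phi>_bound: "cmod (\<phi> f) \<le> 1" if f: "cfunctional f" "\<And>y. cmod (f y) \<le> norm y" for f
  proof (rule field_le_epsilon)
    fix \<epsilon> :: real assume "\<epsilon> > 0"
    then obtain n where "cmod (f (x n) - \<phi> f) < \<epsilon>" using \<phi>[of "{f}" \<epsilon> 0] f(1) by auto
    moreover have "cmod (f (x n)) \<le> 1" using f(2)[of "x n"] x by simp
    ultimately show "cmod (\<phi> f) \<le> 1 + \<epsilon>"
      using norm_triangle_ineq2[of "\<phi> f" "f (x n)"] by (simp add: norm_minus_commute)
  qed
  define B where "B = {f :: 'a \<Rightarrow> complex. cfunctional f \<and> (\<forall>y. cmod (f y) \<le> norm y)}"
  have norming: "\<exists>f\<in>B. cmod (f y) = norm y" for y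
    using norming_functional[of y] unfolding B_def by blast
  define W where "W = {f \<in> B. \<phi> f = 0}"
  have "\<exists>c>0. \<forall>y. \<exists>f\<in>W. c * norm y \<le> cmod (f y)"
  proof (rule ccontr)
    assume "\<not> ?thesis"
    then have neg: "\<exists>y. \<forall>f\<in>W. cmod (f y) < c * norm y" if "c > 0" for c
      using that by (meson not_le)
    show False
    proof (cases "\<forall>f\<in>B. \<phi> f = 0")
      case True
      then have "W = B" by (auto simp: W_def)
      then obtain y where y: "\<And>f. f \<in> B \<Longrightarrow> cmod (f y) < norm y" using neg[of 1] by auto
      obtain f where "f \<in> B" "cmod (f y) = norm y" using norming by blast
      with y[of f] show False by simp
    next
      case False
      then obtain g where g: "g \<in> B" "\<phi> g \<noteq> 0" by blast
      \<comment> \<open>For \<open>f \<in> B\<close> the functional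
        \<open>f - (\<phi> f / \<phi> g) g\<close> is killed by \<open>\<phi>\<close> and has norm
        at most \<open>C\<close>, so dividing it by \<open>C\<close> gives a member of
        \<open>W\<close>. On a unit vector \<open>y\<close> where \<open>W\<close> is small,
        \<open>f y\<close> is therefore close to \<open>\<phi> f / \<phi> g * g y\<close>.\<close>
      define C where "C = 1 + 1 / cmod (\<phi> g)"
      have C: "C \<ge> 1" by (simp add: C_def)
      have key: "\<exists>y. norm y = 1 \<and> (\<forall>f\<in>B. cmod (f y - \<phi> f / \<phi> g * g y) \<le> d)"
        if d: "d > 0" for d
      proof -
        obtain y where y: "\<And>f. f \<in> W \<Longrightarrow> cmod (f y) < d / C * norm y"
          using neg[of "d / C"] d C by auto
        \<comment> \<open>The strict inequality at the zero functional excludes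
          \<open>y = 0\<close>.\<close>
        have zW: "(\<lambda>x. 0) \<in> W"
          using \<phi>_lincomb[of g g 0 0] g by (simp add: W_def B_def cfunctional_zero)
        have "norm y \<noteq> 0" using y[OF zW] by auto
        define w where "w = complex_of_real (1 / norm y) *\<^sub>C y"
        have w: "norm w = 1" using \<open>norm y \<noteq> 0\<close> by (simp add: w_def norm_scaleC norm_divide)
        have wW: "cmod (f w) \<le> d / C" if "f \<in> W" for f
        proof -
          have "cfunctional f" using that by (simp add: W_def B_def)
          then have "cmod (f w) = cmod (f y) / norm y"
            by (simp add: w_def cfunctional_scaleC norm_mult norm_divide)
          moreover have "norm y > 0" using \<open>norm y \<noteq> 0\<close> by simp
          ultimately show ?thesis using y[OF that] by (simp only: pos_divide_le_eq less_imp_le)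
        qed
        have "cmod (f w - \<phi> f / \<phi> g * g w) \<le> d" if f: "f \<in> B" for f
        proof -
          define h where "h x = (1 / of_real C) * f x + (- (\<phi> f / \<phi> g) / of_real C) * g x" for x
          have fc: "cfunctional f" "cfunctional g" using f g by (auto simp: B_def)
          have hc: "cfunctional h" unfolding h_def by (rule cfunctional_lincomb[OF fc])
          have h_eq: "h x = (f x - \<phi> f / \<phi> g * g x) / of_real C" for x
            using C by (simp add: h_def field_simps)
          have "\<phi> h = 0"
            unfolding h_def \<phi>_lincomb[OF fc] using g(2) C by (simp add: field_simps)
          moreover have "cmod (h x) \<le> norm x" for x
          proof -
            have "cmod (\<phi> f / \<phi> g * g x) \<le> 1 / cmod (\<phi> g) * norm x"
              using \<phi>_bound[of f] f g unfolding norm_mult norm_divide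
              by (intro mult_mono divide_right_mono) (auto simp: B_def)
            moreover have "cmod (f x) \<le> norm x" using f by (simp add: B_def)
            ultimately have "cmod (f x - \<phi> f / \<phi> g * g x) \<le> C * norm x"
              using norm_triangle_ineq4[of "f x" "\<phi> f / \<phi> g * g x"]
              by (simp add: C_def algebra_simps)
            then show ?thesis using C by (simp add: h_eq norm_divide field_simps)
          qed
          ultimately have "h \<in> W" using hc by (simp add: W_def B_def)
          from wW[OF this] show ?thesis using C by (simp add: h_eq norm_divide field_simps)
        qed
        then show ?thesis using w by blast
      qed
      have "\<exists>u. \<forall>f\<in>B. cmod (f u - \<phi> f) \<le> d" if d: "0 < d" "d \<le> 1" for d
      proof -
        \<comment> \<open>Rescaling \<open>y\<close> below at most doubles the error, and
          \<open>2 * d' = d * cmod (\<phi> g)\<close> is at most \<open>d\<close>.\<close>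
        define d' where "d' = d * cmod (\<phi> g) / 2"
        have gB: "cmod (\<phi> g) \<le> 1" using \<phi>_bound[of g] g by (simp add: B_def)
        have d': "0 < d'" "d' \<le> 1 / 2"
          using d g(2) gB mult_mono[OF d(2) gB] by (auto simp: d'_def)
        obtain y where y: "norm y = 1" "\<And>f. f \<in> B \<Longrightarrow> cmod (f y - \<phi> f / \<phi> g * g y) \<le> d'"
          using key[OF d'(1)] by blast
        \<comment> \<open>A functional norming \<open>y\<close> shows that \<open>g y\<close> is not
          small, so \<open>y\<close> can be rescaled to give \<open>g\<close> the value
          \<open>\<phi> g\<close>; all other \<open>f \<in> B\<close> then nearly take the value
          \<open>\<phi> f\<close>.\<close>
        obtain f0 where f0: "f0 \<in> B" "cmod (f0 y) = 1" using norming[of y] y(1) by auto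
        have "1 - d' \<le> cmod (\<phi> f0 / \<phi> g * g y)"
          using y(2)[OF f0(1)] f0(2) norm_triangle_ineq2[of "f0 y" "\<phi> f0 / \<phi> g * g y"] by simp
        also have "\<dots> \<le> 1 / cmod (\<phi> g) * cmod (g y)"
          using \<phi>_bound[of f0] f0 unfolding norm_mult norm_divide
          by (intro mult_right_mono divide_right_mono) (auto simp: B_def)
        finally have "(1 - d') * cmod (\<phi> g) \<le> cmod (g y)" using g(2) by (simp add: field_simps)
        moreover have "1 / 2 * cmod (\<phi> g) \<le> (1 - d') * cmod (\<phi> g)"
          using d'(2) by (intro mult_right_mono) auto
        ultimately have gy: "cmod (\<phi> g) / 2 \<le> cmod (g y)" by simp
        define t where "t = \<phi> g / g y"
        have gy0: "g y \<noteq> 0" using gy g(2) by auto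
        have t: "cmod t \<le> 2" using gy gy0 g(2) by (simp add: t_def norm_divide field_simps)
        have "cmod (f (t *\<^sub>C y) - \<phi> f) \<le> d" if f: "f \<in> B" for f
        proof -
          have "f (t *\<^sub>C y) - \<phi> f = t * (f y - \<phi> f / \<phi> g * g y)"
            using f gy0 g(2) by (simp add: B_def cfunctional_scaleC t_def field_simps)
          then have "cmod (f (t *\<^sub>C y) - \<phi> f) \<le> 2 * d'"
            using t y(2)[OF f] by (simp add: norm_mult mult_mono)
          also have "\<dots> \<le> d" using gB d mult_left_mono[OF gB, of d] by (simp add: d'_def)
          finally show ?thesis .
        qed
        then show ?thesis by blast
      qed
      then have "\<exists>u. \<forall>f\<in>B. cmod (f u - \<phi> f) \<le> inverse (real (Suc k))" for k
        by (simp add: inverse_eq_divide)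
      then obtain u where u: "\<And>k f. f \<in> B \<Longrightarrow> cmod (f (u k) - \<phi> f) \<le> inverse (real (Suc k))"
        by metis
      \<comment> \<open>The norm of \<open>u m - u n\<close> is attained by some
        \<open>f \<in> B\<close>, and both \<open>f (u m)\<close> and \<open>f (u n)\<close> are
        close to \<open>\<phi> f\<close>. By completeness \<open>\<phi>\<close> is evaluation at the
        limit \<open>z\<close>.\<close>
      have "Cauchy u"
      proof (rule metric_CauchyI)
        fix r :: real assume "r > 0"
        then obtain M where M: "inverse (real (Suc M)) < r / 2"
          using reals_Archimedean[of "r / 2"] by auto
        have "dist (u m) (u n) < r" if "m \<ge> M" "n \<ge> M" for m n
        proof -
          obtain f where f: "f \<in> B" "cmod (f (u m - u n)) = norm (u m - u n)"
            using norming by blast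
          have "f (u m - u n) = (f (u m) - \<phi> f) - (f (u n) - \<phi> f)"
            using f by (simp add: B_def cfunctional_diff)
          then have "norm (u m - u n) \<le> inverse (real (Suc m)) + inverse (real (Suc n))"
            using f u[OF f(1)] norm_triangle_ineq4[of "f (u m) - \<phi> f" "f (u n) - \<phi> f"]
            by (metis add_mono order_trans)
          also have "\<dots> \<le> inverse (real (Suc M)) + inverse (real (Suc M))"
            using that by (intro add_mono le_imp_inverse_le) auto
          finally show ?thesis using M by (simp add: dist_norm)
        qed
        then show "\<exists>M. \<forall>m\<ge>M. \<forall>n\<ge>M. dist (u m) (u n) < r" by blast
      qed
      then obtain z where z: "u \<longlonglongrightarrow> z"
        using Cauchy_convergent_iff convergent_def by blast
      have fz: "f z = \<phi> f" if f: "f \<in> B" for f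
      proof (rule LIMSEQ_unique)
        have "bounded_linear f" using f by (simp add: B_def cfunctional_def)
        then show "(\<lambda>k. f (u k)) \<longlonglongrightarrow> f z" using z by (rule bounded_linear.tendsto)
        have "(\<lambda>k. f (u k) - \<phi> f) \<longlonglongrightarrow> 0"
          using u[OF f] by (intro Lim_null_comparison[OF _ LIMSEQ_inverse_real_of_nat]) auto
        then show "(\<lambda>k. f (u k)) \<longlonglongrightarrow> \<phi> f" by (simp add: LIM_zero_iff)
      qed
      \<comment> \<open>With \<open>f\<close> norming \<open>A z\<close>, the functional
        \<open>f \<circ> A\<close>, scaled into \<open>B\<close>, tends to 0 along \<open>x\<close>.
        So \<open>\<phi>\<close> kills it, and \<open>\<phi>\<close> is evaluation at
        \<open>z\<close>.\<close>
      have "A z = 0"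
      proof -
        obtain f where f: "f \<in> B" "cmod (f (A z)) = norm (A z)" using norming by blast
        have Ab: "bounded_linear A" using A by (simp add: bounded_clinear_def)
        obtain L where L: "L > 0" "\<And>y. norm (A y) \<le> norm y * L"
          using bounded_linear.pos_bounded[OF Ab] by blast
        define h where "h y = f (A y) / of_real L" for y
        have fc: "cfunctional f" using f by (simp add: B_def)
        have hc: "cfunctional h"
          unfolding cfunctional_def h_def
        proof
          show "bounded_linear (\<lambda>y. f (A y) / complex_of_real L)"
            using bounded_linear_compose[OF cfunctional_bounded_linear[OF fc] Ab]
            by (intro bounded_linear_divide bounded_linear_compose[OF bounded_linear_divide])
          show "\<forall>c x. f (A (c *\<^sub>C x)) / complex_of_real L = c * (f (A x) / complex_of_real L)"
            using A fc by (simp add: bounded_clinear_def cfunctional_def)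
        qed
        have "cmod (h y) \<le> norm y" for y
        proof -
          have "cmod (f (A y)) \<le> norm (A y)" using f by (simp add: B_def)
          then show ?thesis using L(1) L(2)[of y] by (simp add: h_def norm_divide field_simps)
        qed
        then have hB: "h \<in> B" using hc by (simp add: B_def)
        have hx: "(\<lambda>n. h (x n)) \<longlonglongrightarrow> 0"
        proof -
          have "(\<lambda>n. f (A (x n)) / of_real L) \<longlonglongrightarrow> f 0 / of_real L"
            by (intro tendsto_divide bounded_linear.tendsto[OF cfunctional_bounded_linear[OF fc] Ax])
              (use L in auto)
          then show ?thesis
            using fc by (simp add: h_def cfunctional_def bounded_linear.linear linear_0)
        qed
        have "\<phi> h = 0"
        proof (rule ccontr)
          assume "\<phi> h \<noteq> 0"
          then have pos: "cmod (\<phi> h) / 2 > 0" by simp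
          obtain N where N: "\<And>n. n \<ge> N \<Longrightarrow> cmod (h (x n)) < cmod (\<phi> h) / 2"
            using LIMSEQ_D[OF hx pos] by auto
          obtain n where "n \<ge> N" "cmod (h (x n) - \<phi> h) < cmod (\<phi> h) / 2"
            using \<phi>[of "{h}" "cmod (\<phi> h) / 2" N] hc pos by auto
          with N[of n] norm_triangle_ineq2[of "\<phi> h" "h (x n)"] show False
            by (simp add: norm_minus_commute)
        qed
        then have "h z = 0" using fz[OF hB] by simp
        then have "f (A z) = 0" using L by (simp add: h_def)
        then show ?thesis using f by simp
      qed
      then have "z = 0" by (rule inj)
      then have "\<phi> g = 0"
        using fz[OF g(1)] g(1) by (simp add: B_def cfunctional_def bounded_linear.linear linear_0)
      with g show False by simp
    qed
  qed
  then obtain c where c: "c > 0" "\<And>y. \<exists>f\<in>W. c * norm y \<le> cmod (f y)" by blast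
  show thesis
  proof (rule that)
    show "norming_set W c" by standard (use c in \<open>auto simp: W_def B_def\<close>)
    show "\<exists>n. \<forall>f\<in>G. cmod (f (x n)) < \<eta>" if "finite G" "G \<subseteq> W" "\<eta> > 0" for G \<eta>
      using \<phi>[of G \<eta> 0] that by (fastforce simp: W_def B_def)
  qed
qed

section \<open>Half-spaces spanned by minimal sequences\<close>

lemma closure_csubspace:
  fixes S :: "'a::complex_normed_vector set"
  assumes S: "complex_vector.subspace S"
  shows "complex_vector.subspace (closure S)"
proof (rule complex_vector.subspaceI)
  show "0 \<in> closure S" using S closure_subset complex_vector.subspace_0 by blast
next
  fix x y assume "x \<in> closure S" "y \<in> closure S"
  then obtain f g where f: "\<And>n::nat. f n \<in> S" "f \<longlonglongrightarrow> x"
    and g: "\<And>n::nat. g n \<in> S" "g \<longlonglongrightarrow> y"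
    unfolding closure_sequential by blast
  have "(\<lambda>n. f n + g n) \<longlonglongrightarrow> x + y" using f(2) g(2) by (rule tendsto_add)
  moreover have "f n + g n \<in> S" for n using f(1) g(1) by (rule complex_vector.subspace_add[OF S])
  ultimately show "x + y \<in> closure S"
    unfolding closure_sequential by (intro exI[of _ "\<lambda>n. f n + g n"]) simp
next
  fix c x assume "x \<in> closure S"
  then obtain f where f: "\<And>n::nat. f n \<in> S" "f \<longlonglongrightarrow> x"
    unfolding closure_sequential by blast
  have "(\<lambda>n. c *\<^sub>C f n) \<longlonglongrightarrow> c *\<^sub>C x"
    using f(2) by (rule bounded_linear.tendsto[OF bounded_linear_scaleC_right])
  moreover have "c *\<^sub>C f n \<in> S" for n using f(1) by (rule complex_vector.subspace_scale[OF S])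
  ultimately show "c *\<^sub>C x \<in> closure S"
    unfolding closure_sequential by (intro exI[of _ "\<lambda>n. c *\<^sub>C f n"]) simp
qed

text \<open>Coefficients are indexed by position, as in \<open>minimal_sequence\<close>, and every
  \<open>m \<ge> n\<close> is allowed so that the sum can be extended past a given index.\<close>

lemma span_image_sequence:
  fixes v :: "nat \<Rightarrow> 'a::complex_vector"
  assumes "y \<in> complex_vector.span (v ` A)"
  obtains a n where "\<And>k. k \<notin> A \<Longrightarrow> a k = 0" "\<And>m. m \<ge> n \<Longrightarrow> y = (\<Sum>k<m. a k *\<^sub>C v k)"
proof -
  have "\<exists>a n. (\<forall>k. k \<notin> A \<longrightarrow> a k = 0) \<and> (\<forall>m\<ge>n. y = (\<Sum>k<m. a k *\<^sub>C v k))"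
    using assms
  proof (induction rule: complex_vector.span_induct_alt)
    case base
    show ?case by (intro exI[of _ "\<lambda>k. 0"]) simp
  next
    case (step c x y)
    then obtain i a n where i: "i \<in> A" "x = v i" and a: "\<And>k. k \<notin> A \<Longrightarrow> a k = 0"
      "\<And>m. m \<ge> n \<Longrightarrow> y = (\<Sum>k<m. a k *\<^sub>C v k)" by blast
    have "c *\<^sub>C x + y = (\<Sum>k<m. (a k + (if k = i then c else 0)) *\<^sub>C v k)" if "m \<ge> max n (Suc i)" for m
    proof -
      have "(\<Sum>k<m. (a k + (if k = i then c else 0)) *\<^sub>C v k)
          = (\<Sum>k<m. a k *\<^sub>C v k) + (\<Sum>k<m. if k = i then c *\<^sub>C v k else 0)"
        unfolding sum.distrib[symmetric] by (intro sum.cong) (auto simp: scaleC_add_left)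
      then show ?thesis using that i a by simp
    qed
    moreover have "a k + (if k = i then c else 0) = 0" if "k \<notin> A" for k
      using that i a by auto
    ultimately show ?case
      by (intro exI[of _ "\<lambda>k. a k + (if k = i then c else 0)"] exI[of _ "max n (Suc i)"]) simp
  qed
  then show thesis using that by blast
qed

text \<open>As \<open>j \<notin> A\<close>, the number \<open>c\<close> is exactly the coefficient
  of index \<open>j\<close>. One constant serves all \<open>A\<close>, since it depends on
  \<open>j\<close> only.\<close>

lemma minimal_sequence_dist:
  fixes v :: "nat \<Rightarrow> 'a::complex_normed_vector"
  assumes v: "minimal_sequence v"
  obtains L where "L > 0"
    "\<And>A y c. \<lbrakk>j \<notin> A; y \<in> complex_vector.span (v ` A)\<rbrakk> \<Longrightarrow> cmod c \<le> L * norm (c *\<^sub>C v j + y)"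
proof -
  obtain L where L: "\<And>m a. j < m \<Longrightarrow> cmod (a j) \<le> L * norm (\<Sum>k<m. a k *\<^sub>C v k)"
    using v unfolding minimal_sequence_def by blast
  \<comment> \<open>The maximum with 1 makes the constant positive.\<close>
  show thesis
  proof (rule that[of "max L 1"])
    fix A y c assume j: "j \<notin> A" and y: "y \<in> complex_vector.span (v ` A)"
    obtain a n where a: "\<And>k. k \<notin> A \<Longrightarrow> a k = 0" "\<And>m. m \<ge> n \<Longrightarrow> y = (\<Sum>k<m. a k *\<^sub>C v k)"
      using span_image_sequence[OF y] by blast
    \<comment> \<open>Long enough for index \<open>j\<close> to occur in the sum.\<close>
    define m where "m = max n (Suc j)"
    define b where "b k = a k + (if k = j then c else 0)" for k
    have "(\<Sum>k<m. b k *\<^sub>C v k) = (\<Sum>k<m. a k *\<^sub>C v k) + (\<Sum>k<m. if k = j then c *\<^sub>C v k else 0)"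
      unfolding sum.distrib[symmetric] b_def by (intro sum.cong) (auto simp: scaleC_add_left)
    also have "\<dots> = c *\<^sub>C v j + y" using a(2)[of m] by (simp add: m_def less_max_iff_disj)
    finally have "(\<Sum>k<m. b k *\<^sub>C v k) = c *\<^sub>C v j + y" .
    moreover have "cmod (b j) \<le> L * norm (\<Sum>k<m. b k *\<^sub>C v k)" by (rule L) (simp add: m_def)
    moreover have "b j = c" using a(1)[OF j] by (simp add: b_def)
    ultimately have "cmod c \<le> L * norm (c *\<^sub>C v j + y)" by simp
    also have "\<dots> \<le> max L 1 * norm (c *\<^sub>C v j + y)" by (intro mult_right_mono) auto
    finally show "cmod c \<le> max L 1 * norm (c *\<^sub>C v j + y)" .
  qed simp
qed

text \<open>The coefficient of \<open>v j\<close> in \<open>y - v j\<close> is -1, so the span stays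
  at distance at least \<open>1 / L\<close> from \<open>v j\<close>.\<close>

lemma minimal_sequence_not_in_closure:
  fixes v :: "nat \<Rightarrow> 'a::complex_normed_vector"
  assumes v: "minimal_sequence v" and j: "j \<notin> A"
  shows "v j \<notin> closure (complex_vector.span (v ` A))"
proof
  assume cl: "v j \<in> closure (complex_vector.span (v ` A))"
  obtain L where L: "L > 0"
    "\<And>A y c. \<lbrakk>j \<notin> A; y \<in> complex_vector.span (v ` A)\<rbrakk> \<Longrightarrow> cmod c \<le> L * norm (c *\<^sub>C v j + y)"
    using minimal_sequence_dist[OF v, of j] by blast
  obtain y where y: "y \<in> complex_vector.span (v ` A)" "dist y (v j) < 1 / L"
    using cl L(1) unfolding closure_approachable by (meson zero_less_divide_1_iff)
  have "cmod (-1) \<le> L * norm ((-1) *\<^sub>C v j + y)" by (rule L(2)[OF j y(1)])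
  then have "1 \<le> L * norm (y - v j)" by simp
  with y(2) L(1) show False by (simp add: dist_norm field_simps)
qed

lemma infinite_independent_not_fin_dim:
  assumes "infinite I" "\<not> complex_vector.dependent I" "I \<subseteq> Y"
  shows "\<not> fin_dim_subspace Y"
  using complex_vector.independent_span_bound assms unfolding fin_dim_subspace_def by blast

text \<open>The vectors of \<open>v\<close> over \<open>A\<close> are independent, which gives
  infinite dimension; those over \<open>B\<close> stay independent modulo the closed span, which
  gives infinite codimension.\<close>

lemma minimal_sequence_half_space:
  fixes v :: "nat \<Rightarrow> 'a::complex_normed_vector"
  assumes v: "minimal_sequence v" and A: "infinite A" and B: "infinite B" and AB: "A \<inter> B = {}"
  shows "half_space (closure (complex_vector.span (v ` A)))"
proof -
  define Z where "Z X = closure (complex_vector.span (v ` X))" for X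
  have Z_sub: "complex_vector.subspace (Z X)" for X
    unfolding Z_def by (intro closure_csubspace complex_vector.subspace_span)
  have Z_mem: "v i \<in> Z X" if "i \<in> X" for i X
    unfolding Z_def using that by (intro subsetD[OF closure_subset] complex_vector.span_base imageI)
  have Z_mono: "Z X \<subseteq> Z X'" if "X \<subseteq> X'" for X X'
    unfolding Z_def using that by (intro closure_mono complex_vector.span_mono image_mono)
  have notin: "v j \<notin> Z X" if "j \<notin> X" for j X
    unfolding Z_def by (rule minimal_sequence_not_in_closure[OF v that])
  have "\<not> fin_dim_subspace (Z A)"
  proof (rule infinite_independent_not_fin_dim)
    have "inj v"
    proof (rule injI, rule ccontr)
      fix i j assume "v i = v j" "i \<noteq> j"
      with notin[of j "{i}"] Z_mem[of i "{i}"] show False by simp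
    qed
    then show "infinite (v ` A)" using A by (simp add: finite_image_iff inj_on_subset)
    show "\<not> complex_vector.dependent (v ` A)"
    proof
      assume "complex_vector.dependent (v ` A)"
      then obtain j where "j \<in> A" "v j \<in> complex_vector.span (v ` A - {v j})"
        unfolding complex_vector.dependent_def by blast
      moreover have "complex_vector.span (v ` A - {v j}) \<subseteq> complex_vector.span (v ` (A - {j}))"
        by (intro complex_vector.span_mono) auto
      ultimately have "v j \<in> Z (A - {j})" unfolding Z_def using closure_subset by blast
      with notin[of j "A - {j}"] show False by simp
    qed
    show "v ` A \<subseteq> Z A" using Z_mem by blast
  qed
  moreover have "\<not> fin_codim_subspace (Z A)"
  proof
    assume "fin_codim_subspace (Z A)"
    then obtain M where M: "fin_dim_subspace M" "Z A + M = UNIV"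
      unfolding fin_codim_subspace_def by blast
    have "\<exists>y m. y \<in> Z A \<and> m \<in> M \<and> v j = y + m" for j
    proof -
      have "v j \<in> Z A + M" using M(2) by simp
      then show ?thesis unfolding set_plus_def by blast
    qed
    \<comment> \<open>\<open>m j\<close> represents \<open>v j\<close> modulo \<open>Z A\<close>.
      For \<open>j \<in> B\<close> the subspace \<open>Z (- {j})\<close> contains \<open>Z A\<close>
      and every other \<open>m i\<close> but not \<open>m j\<close>, which makes these
      \<open>m j\<close> independent.\<close>
    then obtain y m where ym: "\<And>j. y j \<in> Z A" "\<And>j. m j \<in> M" "\<And>j. v j = y j + m j" by metis
    have m_eq: "m i = v i - y i" for i using ym(3)[of i] by simp
    have y_in: "y i \<in> Z (- {j})" if "j \<in> B" for i j
      using ym(1) Z_mono[of A "- {j}"] that AB by blast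
    have m_in: "m i \<in> Z (- {j})" if "j \<in> B" "i \<noteq> j" for i j
      unfolding m_eq using that by (intro complex_vector.subspace_diff[OF Z_sub] Z_mem y_in) auto
    have m_notin: "m j \<notin> Z (- {j})" if "j \<in> B" for j
    proof
      assume "m j \<in> Z (- {j})"
      then have "v j \<in> Z (- {j})"
        unfolding ym(3) by (intro complex_vector.subspace_add[OF Z_sub] y_in that)
      with notin[of j "- {j}"] show False by simp
    qed
    have "\<not> fin_dim_subspace M"
    proof (rule infinite_independent_not_fin_dim)
      have "inj_on m B"
        by (rule inj_onI, rule ccontr) (metis m_in m_notin)
      then show "infinite (m ` B)" using B by (simp add: finite_image_iff)
      show "\<not> complex_vector.dependent (m ` B)"
      proof
        assume "complex_vector.dependent (m ` B)"
        then obtain j where j: "j \<in> B" "m j \<in> complex_vector.span (m ` B - {m j})"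
          unfolding complex_vector.dependent_def by blast
        have "m ` B - {m j} \<subseteq> Z (- {j})"
        proof
          fix z assume "z \<in> m ` B - {m j}"
          then obtain i where "z = m i" "i \<noteq> j" by blast
          then show "z \<in> Z (- {j})" using m_in[OF j(1)] by simp
        qed
        then have "complex_vector.span (m ` B - {m j}) \<subseteq> Z (- {j})"
          using Z_sub by (rule complex_vector.span_minimal)
        with j m_notin show False by blast
      qed
      show "m ` B \<subseteq> M" using ym(2) by blast
    qed
    with M(1) show False by simp
  qed
  ultimately show ?thesis
    using Z_sub[of A] unfolding half_space_def Z_def by simp
qed

text \<open>On the algebraic span the inclusion is immediate. It survives the closure because
  minimality bounds the coefficients of \<open>v j\<close> by the images, so they converge along
  with them.\<close>

lemma minimal_sequence_image_closure:
  fixes v :: "nat \<Rightarrow> 'a::complex_normed_vector"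
  assumes v: "minimal_sequence v" and j: "j \<notin> A" and T: "bounded_clinear T"
    and Tv: "\<And>k. k \<in> A \<Longrightarrow> T (v k) = l k *\<^sub>C v k + c k *\<^sub>C v j"
  shows "T ` closure (complex_vector.span (v ` A))
    \<subseteq> closure (complex_vector.span (v ` A)) + complex_vector.span {v j}"
proof
  let ?S = "complex_vector.span (v ` A)"
  interpret T: bounded_linear T using T by (simp add: bounded_clinear_def)
  have Tc: "T (a *\<^sub>C y) = a *\<^sub>C T y" for a y using T by (simp add: bounded_clinear_def)
  have span: "\<exists>a. T y - a *\<^sub>C v j \<in> ?S" if "y \<in> ?S" for y
    using that
  proof (induction rule: complex_vector.span_induct_alt)
    case base
    show ?case by (intro exI[of _ 0]) (simp add: T.zero complex_vector.span_zero)
  next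
    case (step r x y)
    then obtain k a where k: "k \<in> A" "x = v k" and a: "T y - a *\<^sub>C v j \<in> ?S" by blast
    have "T (r *\<^sub>C x + y) - (r * c k + a) *\<^sub>C v j = (r * l k) *\<^sub>C v k + (T y - a *\<^sub>C v j)"
      by (simp add: T.add Tc k Tv scaleC_add_right scaleC_add_left scaleC_scaleC)
    also have "\<dots> \<in> ?S"
      using k(1) by (intro complex_vector.span_add[OF _ a] complex_vector.span_scale
          complex_vector.span_base imageI)
    finally show ?case by blast
  qed
  obtain L where L: "L > 0"
    "\<And>A y c. \<lbrakk>j \<notin> A; y \<in> complex_vector.span (v ` A)\<rbrakk> \<Longrightarrow> cmod c \<le> L * norm (c *\<^sub>C v j + y)"
    using minimal_sequence_dist[OF v, of j] by blast
  fix z assume "z \<in> T ` closure ?S"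
  then obtain y where y: "y \<in> closure ?S" "z = T y" by blast
  then obtain f where f: "\<And>n::nat. f n \<in> ?S" "f \<longlonglongrightarrow> y" unfolding closure_sequential by blast
  have "\<forall>n. \<exists>r. T (f n) - r *\<^sub>C v j \<in> ?S" using span f(1) by simp
  from choice[OF this] obtain a where a: "\<And>n. T (f n) - a n *\<^sub>C v j \<in> ?S" by auto
  have Tf: "(\<lambda>n. T (f n)) \<longlonglongrightarrow> z" unfolding y(2) using f(2) by (rule T.tendsto)
  have "Cauchy a"
  proof (rule metric_CauchyI)
    fix r :: real assume "r > 0"
    then have "r / L > 0" using L(1) by simp
    moreover have "Cauchy (\<lambda>n. T (f n))" using Tf by (rule LIMSEQ_imp_Cauchy)
    ultimately obtain M where M: "\<And>m n. \<lbrakk>m \<ge> M; n \<ge> M\<rbrakk> \<Longrightarrow> dist (T (f m)) (T (f n)) < r / L"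
      using metric_CauchyD by blast
    have "dist (a m) (a n) < r" if "m \<ge> M" "n \<ge> M" for m n
    proof -
      \<comment> \<open>This vector is \<open>T (f m) - T (f n)\<close> minus
        \<open>(a m - a n) *\<^sub>C v j\<close>, so \<open>minimal_sequence_dist\<close> controls
        \<open>a m - a n\<close>.\<close>
      have "(T (f m) - a m *\<^sub>C v j) - (T (f n) - a n *\<^sub>C v j) \<in> ?S"
        by (rule complex_vector.span_diff[OF a a])
      from L(2)[OF j this, of "a m - a n"]
      have "cmod (a m - a n) \<le> L * norm (T (f m) - T (f n))"
        by (simp add: complex_vector.scale_left_diff_distrib)
      also have "\<dots> < r" using M[OF that] L(1) by (simp add: dist_norm field_simps)
      finally show ?thesis by (simp add: dist_norm)
    qed
    then show "\<exists>M. \<forall>m\<ge>M. \<forall>n\<ge>M. dist (a m) (a n) < r" by blast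
  qed
  then obtain b where "a \<longlonglongrightarrow> b" using Cauchy_convergent_iff convergent_def by blast
  then have "(\<lambda>n. T (f n) - a n *\<^sub>C v j) \<longlonglongrightarrow> z - b *\<^sub>C v j"
    by (intro tendsto_diff Tf bounded_linear.tendsto[OF bounded_linear_scaleC_left])
  then have "z - b *\<^sub>C v j \<in> closure ?S"
    unfolding closure_sequential using a by (intro exI[of _ "\<lambda>n. T (f n) - a n *\<^sub>C v j"]) simp
  moreover have "b *\<^sub>C v j \<in> complex_vector.span {v j}"
    by (intro complex_vector.span_scale complex_vector.span_base) simp
  ultimately have "(z - b *\<^sub>C v j) + b *\<^sub>C v j \<in> closure ?S + complex_vector.span {v j}"
    by (rule set_plus_intro)
  then show "z \<in> closure ?S + complex_vector.span {v j}" by simp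
qed

section \<open>Computing the defect\<close>

lemma fin_dim_subspace_dim_0:
  assumes M: "fin_dim_subspace M" and dim: "complex_vector.dim M = 0"
  shows "M = {0}"
proof -
  obtain F where F: "finite F" "M = complex_vector.span F" using M by (auto simp: fin_dim_subspace_def)
  obtain B where B: "B \<subseteq> M" "\<not> complex_vector.dependent B" "M \<subseteq> complex_vector.span B" "card B = 0"
    using complex_vector.basis_exists[of M] dim by metis
  \<comment> \<open>\<open>card B = 0\<close> also holds for infinite \<open>B\<close>, so
    finiteness comes first.\<close>
  have "finite B" using complex_vector.independent_span_bound[OF F(1) B(2)] B(1) F(2) by simp
  then have "M \<subseteq> {0}" using B(3,4) by simp
  moreover have "0 \<in> M" unfolding F(2) by (rule complex_vector.span_zero)
  ultimately show ?thesis by blast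
qed

lemma defect_eq_1:
  fixes T :: "'a::complex_normed_vector \<Rightarrow> 'a"
  assumes e: "e \<noteq> 0" and sub: "T ` Y \<subseteq> Y + complex_vector.span {e}" and not: "\<not> T ` Y \<subseteq> Y"
  shows "defect T Y = 1"
  unfolding defect_def
proof (rule Least_equality)
  have "complex_vector.dim (complex_vector.span {e}) = card {e}"
    using e by (intro complex_vector.dim_eq_card) (simp_all add: complex_vector.span_span)
  then show "\<exists>M. fin_dim_subspace M \<and> complex_vector.dim M = 1 \<and> T ` Y \<subseteq> Y + M"
    using sub by (intro exI[of _ "complex_vector.span {e}"]) (auto simp: fin_dim_subspace_def)
next
  fix n assume "\<exists>M. fin_dim_subspace M \<and> complex_vector.dim M = n \<and> T ` Y \<subseteq> Y + M"
  then obtain M where M: "fin_dim_subspace M" "complex_vector.dim M = n" "T ` Y \<subseteq> Y + M" by blast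
  have "n \<noteq> 0"
  proof
    assume "n = 0"
    \<comment> \<open>Here \<open>0\<close> is the set \<open>{0}\<close>, the neutral element of
      set addition.\<close>
    then have "M = 0" using fin_dim_subspace_dim_0[of M] M by (simp add: set_zero)
    with M(3) not show False by simp
  qed
  then show "1 \<le> n" by simp
qed

section \<open>Assembly of the half-space\<close>

theorem theorem2p3:
  fixes T :: "'a::complex_banach \<Rightarrow> 'a"
  assumes "bounded_clinear T"
    and "\<exists>\<mu>. \<mu> \<in> frontier (spectrum T) \<and> \<not> eigenvalue T \<mu>"
  shows "\<exists>Y. half_space Y \<and> almost_invariant T Y \<and> defect T Y = 1"
proof -
  obtain \<mu> where \<mu>: "\<mu> \<in> frontier (spectrum T)" "\<not> eigenvalue T \<mu>" using assms(2) by blast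
  obtain e and x :: "nat \<Rightarrow> 'a" and l c where e: "e \<noteq> 0" and x: "\<And>n. norm (x n) = 1"
    and c: "\<And>n. c n \<noteq> 0" and Tx: "\<And>n. T (x n) = l n *\<^sub>C x n + c n *\<^sub>C e"
    and lim: "(\<lambda>n. T (x n) - \<mu> *\<^sub>C x n) \<longlonglongrightarrow> 0"
    by (rule normalized_resolvent_vectors[OF assms(1) \<mu>(1)]) (rule that; (assumption | simp))
  have A: "bounded_clinear (\<lambda>y. T y - \<mu> *\<^sub>C y)"
    unfolding bounded_clinear_def
  proof
    show "bounded_linear (\<lambda>y. T y - \<mu> *\<^sub>C y)"
      using bounded_clinear_bounded_linear[OF assms(1)] bounded_linear_scaleC_right
      by (rule bounded_linear_sub)
    show "\<forall>a y. T (a *\<^sub>C y) - \<mu> *\<^sub>C a *\<^sub>C y = a *\<^sub>C (T y - \<mu> *\<^sub>C y)"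
      by (simp add: bounded_clinear_scaleC[OF assms(1)] complex_vector.scale_right_diff_distrib
          scaleC_scaleC mult.commute)
  qed
  have inj: "z = 0" if "T z - \<mu> *\<^sub>C z = 0" for z
    using that \<mu>(2) unfolding eigenvalue_def by auto
  obtain W C where W: "norming_set W C"
    and null: "\<And>G \<eta>. \<lbrakk>finite G; G \<subseteq> W; \<eta> > 0\<rbrakk> \<Longrightarrow> \<exists>n. \<forall>f\<in>G. cmod (f (x n)) < \<eta>"
    using norming_null_functionals[OF x A lim inj] by blast
  interpret norming_set W C by (rule W)
  obtain v where v: "v 0 = e" "\<And>k. v (Suc k) \<in> range x" "minimal_sequence v"
    by (rule minimal_sequence_exists[OF x e]) ((rule null; assumption), (rule that; (assumption | simp)))
  have "\<forall>k. \<exists>n. v (Suc k) = x n" using v(2) by auto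
  from choice[OF this] obtain h where h: "\<And>k. v (Suc k) = x (h k)" by auto
  \<comment> \<open>The odd indices leave out 0, the place of \<open>e\<close>, and leave infinitely
    many even ones for the codimension.\<close>
  define A where "A = {k :: nat. odd k}"
  define Y where "Y = closure (complex_vector.span (v ` A))"
  have "0 \<notin> A" by (simp add: A_def)
  have e_notin: "e \<notin> Y"
    using minimal_sequence_not_in_closure[OF v(3) \<open>0 \<notin> A\<close>] v(1) by (simp add: Y_def)
  have half: "half_space Y"
    unfolding Y_def
  proof (rule minimal_sequence_half_space[OF v(3)])
    show "infinite A" "infinite {k :: nat. even k}"
      unfolding A_def infinite_nat_iff_unbounded by (simp_all, (metis even_Suc less_Suc_eq)+)
    show "A \<inter> {k. even k} = {}" by (auto simp: A_def)
  qed
  \<comment> \<open>Position 0 holds \<open>e\<close>, so term \<open>k\<close> of \<open>v\<close>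
    is the vector of \<open>x\<close> chosen at \<open>k - 1\<close>.\<close>
  have Tv: "T (v k) = l (h (k - 1)) *\<^sub>C v k + c (h (k - 1)) *\<^sub>C v 0" if "k \<in> A" for k
  proof -
    have "v k = x (h (k - 1))" using that h[of "k - 1"] by (simp add: A_def odd_pos)
    then show ?thesis using Tx v(1) by simp
  qed
  have sub: "T ` Y \<subseteq> Y + complex_vector.span {e}"
    using minimal_sequence_image_closure[OF v(3) \<open>0 \<notin> A\<close> assms(1), of "\<lambda>k. l (h (k - 1))" "\<lambda>k. c (h (k - 1))"] Tv
    unfolding Y_def v(1) by simp
  have Y_sub: "complex_vector.subspace Y" and "closed Y"
    using half by (auto simp: half_space_def)
  moreover have "fin_dim_subspace (complex_vector.span {e})"
    unfolding fin_dim_subspace_def by (intro exI[of _ "{e}"]) simp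
  ultimately have "almost_invariant T Y"
    using sub unfolding almost_invariant_def by blast
  \<comment> \<open>The term \<open>v 1 = x (h 0)\<close> lies in \<open>Y\<close>; invariance would
    put the nonzero multiple \<open>c (h 0) *\<^sub>C e\<close> there as well.\<close>
  moreover have "\<not> T ` Y \<subseteq> Y"
  proof
    assume TY: "T ` Y \<subseteq> Y"
    have xY: "x (h 0) \<in> Y"
      unfolding Y_def h[symmetric] A_def
      by (intro subsetD[OF closure_subset] complex_vector.span_base imageI) simp
    then have "T (x (h 0)) - l (h 0) *\<^sub>C x (h 0) \<in> Y"
      using TY by (intro complex_vector.subspace_diff[OF Y_sub] complex_vector.subspace_scale[OF Y_sub]) auto
    then have "c (h 0) *\<^sub>C e \<in> Y" by (simp add: Tx)
    then have "inverse (c (h 0)) *\<^sub>C (c (h 0) *\<^sub>C e) \<in> Y"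
      by (rule complex_vector.subspace_scale[OF Y_sub])
    moreover have "inverse (c (h 0)) *\<^sub>C (c (h 0) *\<^sub>C e) = e"
      using c[of "h 0"] by (simp add: scaleC_scaleC)
    ultimately show False using e_notin by simp
  qed
  then have "defect T Y = 1" by (rule defect_eq_1[OF e sub])
  ultimately show ?thesis using half by blast
qed

end
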